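(* For any $0<T<2+2\sqrt2$, there exist a constant $C>0$ and a family $(z^\varepsilon)_{\varepsilon>0}$ of solutions to the adjoint problem $$z_t=-z_x+\varepsilon z_{xx}\ \text{in }(0,T)\times(0,1),\qquad z(\cdot,0)=z(\cdot,1)=0\ \text{in }(0,T),$$ with initial data $z^\varepsilon(0,\cdot)\in H_0^1(0,1)\cap H^2(0,1)$, such that $$\frac{\|z^\varepsilon(T,\cdot)\|_{L^2(0,1)}^2}{\|\varepsilon\,\partial_xz^\varepsilon(\cdot,0)\|_{L^2(0,T)}^2}\ \ge\ C\,\varepsilon^9\exp\left(\frac{2+2\sqrt2-T}{2\varepsilon}\right)$$ for all sufficiently small $\varepsilon>0$. In particular, for all sufficiently small $\varepsilon>0$, the null-controllability cost $C_\varepsilon(T,1,-1)$ (defined in the context) satisfies $$C_\varepsilon(T,1,-1)\ \ge\ \sqrt{C}\,\varepsilon^{9/2}\exp\left(\frac{2+2\sqrt2-T}{4\varepsilon}\right).$$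
   Context: For $T,\varepsilon>0$, the cost $C_\varepsilon(T,1,-1)$ is defined as follows. Consider the control system $$u_t-u_x=\varepsilon u_{xx}\ \text{in }(0,T)\times(0,1),\qquad u(\cdot,0)=f,\quad u(\cdot,1)=0\ \text{in }(0,T),\qquad u(0,\cdot)=u_0\ \text{in }(0,1),$$ with $u_0\in L^2(0,1)$ and boundary control $f\in L^2(0,T)$ (for $L^2$ boundary data, solutions are understood in the standard transposition sense). It is classical that for any $u_0\in L^2(0,1)$ there exists $f\in L^2(0,T)$ such that $u(T,\cdot)\equiv0$. Let $f_{u_0}$ be such a control of minimal $L^2(0,T)$-norm and set $$C_\varepsilon(T,1,-1):=\sup_{\|u_0\|_{L^2(0,1)}\le1}\|f_{u_0}\|_{L^2(0,T)}.$$ *)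

theory Defs
  imports "HOL-Analysis.Analysis"
begin

section \<open>Square-integrable functions and Sobolev spaces on the unit interval\<close>

text \<open>
  Elements of Lebesgue and Sobolev spaces are represented by functions of type
  \<^typ>\<open>real \<Rightarrow> real\<close>; only the values on the interval in question matter.
\<close>

definition L2 :: "real set \<Rightarrow> (real \<Rightarrow> real) set" where
  "L2 S = {v. set_borel_measurable lborel S v \<and> set_integrable lborel S (\<lambda>x. (v x)\<^sup>2)}"

definition L2_norm :: "real set \<Rightarrow> (real \<Rightarrow> real) \<Rightarrow> real" where
  "L2_norm S v = sqrt (LBINT x:S. (v x)\<^sup>2)"

definition test_function :: "(real \<Rightarrow> real) \<Rightarrow> bool" where
  "test_function \<psi> \<longleftrightarrow>
     (\<forall>n. ((deriv ^^ n) \<psi>) differentiable_on UNIV) \<and>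
     (\<exists>a b. 0 < a \<and> b < 1 \<and> (\<forall>x. x \<notin> {a..b} \<longrightarrow> \<psi> x = 0))"

definition has_weak_deriv :: "(real \<Rightarrow> real) \<Rightarrow> (real \<Rightarrow> real) \<Rightarrow> bool" where
  "has_weak_deriv v g \<longleftrightarrow>
     v \<in> L2 {0<..<1} \<and> g \<in> L2 {0<..<1} \<and>
     (\<forall>\<psi>. test_function \<psi> \<longrightarrow>
        (LBINT x:{0<..<1}. v x * deriv \<psi> x) = - (LBINT x:{0<..<1}. g x * \<psi> x))"

definition H1 :: "(real \<Rightarrow> real) set" where
  "H1 = {v. \<exists>g. has_weak_deriv v g}"

definition H2 :: "(real \<Rightarrow> real) set" where
  "H2 = {v. \<exists>g h. has_weak_deriv v g \<and> has_weak_deriv g h}"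

text \<open>
  An element of \<open>H10\<close> is identified with its continuous representative on \<open>[0,1]\<close>, so that
  the boundary values are literal ones.
\<close>

definition H10 :: "(real \<Rightarrow> real) set" where
  "H10 = {v \<in> H1. continuous_on {0..1} v \<and> v 0 = 0 \<and> v 1 = 0}"

definition H1_norm :: "(real \<Rightarrow> real) \<Rightarrow> real" where
  "H1_norm v =
     sqrt ((L2_norm {0<..<1} v)\<^sup>2 + (L2_norm {0<..<1} (SOME g. has_weak_deriv v g))\<^sup>2)"

text \<open>
  The trace \<open>v'(0)\<close>. For \<open>v \<in> H10 \<inter> H2\<close> the function \<open>v\<close> is continuously differentiable on
  \<open>[0,1]\<close>, because \<open>H\<^sup>2(0,1)\<close> embeds into \<open>C\<^sup>1([0,1])\<close>; the trace is then its one-sided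
  derivative at \<open>0\<close>.
\<close>

definition left_trace_deriv :: "(real \<Rightarrow> real) \<Rightarrow> real" where
  "left_trace_deriv v = vector_derivative v (at 0 within {0..1})"

text \<open>
  The space \<open>H\<^sup>-\<^sup>1(0,1)\<close>, dual of \<open>H10\<close>: functionals are only meaningful on \<open>H10\<close>.
\<close>

definition Hm1 :: "((real \<Rightarrow> real) \<Rightarrow> real) set" where
  "Hm1 = {\<Lambda>.
     (\<forall>v\<in>H10. \<forall>w\<in>H10. \<forall>a b. \<Lambda> (\<lambda>x. a * v x + b * w x) = a * \<Lambda> v + b * \<Lambda> w) \<and>
     (\<exists>K. \<forall>v\<in>H10. \<bar>\<Lambda> v\<bar> \<le> K * H1_norm v)}"

definition Hm1_norm :: "((real \<Rightarrow> real) \<Rightarrow> real) \<Rightarrow> real" where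
  "Hm1_norm \<Lambda> = (SUP v\<in>{v \<in> H10. H1_norm v \<le> 1}. \<bar>\<Lambda> v\<bar>)"


section \<open>The adjoint problem\<close>

definition L2_continuous :: "real \<Rightarrow> (real \<Rightarrow> real \<Rightarrow> real) \<Rightarrow> bool" where
  "L2_continuous T w \<longleftrightarrow>
     (\<forall>t\<in>{0..T}. ((\<lambda>s. L2_norm {0<..<1} (\<lambda>x. w s x - w t x)) \<longlongrightarrow> 0) (at t within {0..T}))"

text \<open>
  Solutions of \<open>z\<^sub>t = - z\<^sub>x + \<epsilon> z\<^sub>x\<^sub>x\<close> with homogeneous Dirichlet conditions, in the class
  \<open>C([0,T]; H10 \<inter> H2) \<inter> C\<^sup>1([0,T]; L\<^sup>2(0,1))\<close>, which is the regularity of the solutions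
  whose initial data lie in \<open>H10 \<inter> H2\<close>, the domain of the generator.
\<close>

definition adjoint_solution :: "real \<Rightarrow> real \<Rightarrow> (real \<Rightarrow> real \<Rightarrow> real) \<Rightarrow> bool" where
  "adjoint_solution \<epsilon> T z \<longleftrightarrow>
     (\<exists>z_t z_x z_xx.
        (\<forall>t\<in>{0..T}.
           z t \<in> H10 \<inter> H2 \<and>
           has_weak_deriv (z t) (z_x t) \<and>
           has_weak_deriv (z_x t) (z_xx t) \<and>
           z_t t \<in> L2 {0<..<1} \<and>
           ((\<lambda>s. L2_norm {0<..<1} (\<lambda>x. (z s x - z t x) / (s - t) - z_t t x)) \<longlongrightarrow> 0)
             (at t within {0..T}) \<and>
           (AE x in lborel. x \<in> {0<..<1} \<longrightarrow> z_t t x = - z_x t x + \<epsilon> * z_xx t x)) \<and>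
        L2_continuous T z \<and> L2_continuous T z_x \<and> L2_continuous T z_xx \<and>
        L2_continuous T z_t)"


section \<open>The control problem and its cost\<close>

text \<open>
  Transposition solutions \<open>u \<in> C([0,T]; H\<^sup>-\<^sup>1(0,1))\<close> of
  \<open>u\<^sub>t - u\<^sub>x = \<epsilon> u\<^sub>x\<^sub>x\<close>, \<open>u(\<cdot>,0) = f\<close>, \<open>u(\<cdot>,1) = 0\<close>, \<open>u(0,\<cdot>) = u0\<close>.
  The tests \<open>\<phi>\<close> solve the backward problem
  \<open>- \<phi>\<^sub>t + \<phi>\<^sub>x - \<epsilon> \<phi>\<^sub>x\<^sub>x = 0\<close> on \<open>(0,\<tau>) \<times> (0,1)\<close> with zero lateral boundary values, that is,
  \<open>t \<mapsto> \<phi>(\<tau> - t)\<close> solves the adjoint problem; the identity results from multiplying the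
  equation for \<open>u\<close> by \<open>\<phi>\<close> and integrating by parts over \<open>(0,\<tau>) \<times> (0,1)\<close>. The final values
  \<open>\<phi>(\<tau>)\<close> range over \<open>H10 \<inter> H2\<close>, which is dense in \<open>H10\<close>.
\<close>

definition transposition_solution ::
  "real \<Rightarrow> real \<Rightarrow> (real \<Rightarrow> real) \<Rightarrow> (real \<Rightarrow> real) \<Rightarrow> (real \<Rightarrow> (real \<Rightarrow> real) \<Rightarrow> real) \<Rightarrow> bool"
where
  "transposition_solution \<epsilon> T u0 f u \<longleftrightarrow>
     (\<forall>t\<in>{0..T}. u t \<in> Hm1 \<and>
        ((\<lambda>s. Hm1_norm (\<lambda>v. u s v - u t v)) \<longlongrightarrow> 0) (at t within {0..T})) \<and>
     (\<forall>\<tau>\<in>{0..T}. \<forall>\<phi>. adjoint_solution \<epsilon> \<tau> (\<lambda>t. \<phi> (\<tau> - t)) \<longrightarrow>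
        u \<tau> (\<phi> \<tau>) = (LBINT x:{0<..<1}. u0 x * \<phi> 0 x)
                     + \<epsilon> * (LBINT t:{0<..<\<tau>}. f t * left_trace_deriv (\<phi> t)))"

definition null_control :: "real \<Rightarrow> real \<Rightarrow> (real \<Rightarrow> real) \<Rightarrow> (real \<Rightarrow> real) \<Rightarrow> bool" where
  "null_control \<epsilon> T u0 f \<longleftrightarrow>
     f \<in> L2 {0<..<T} \<and>
     (\<exists>u. transposition_solution \<epsilon> T u0 f u \<and> (\<forall>v\<in>H10. u T v = 0))"

definition minimal_null_control :: "real \<Rightarrow> real \<Rightarrow> (real \<Rightarrow> real) \<Rightarrow> (real \<Rightarrow> real) \<Rightarrow> bool" where
  "minimal_null_control \<epsilon> T u0 f \<longleftrightarrow>
     null_control \<epsilon> T u0 f \<and>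
     (\<forall>g. null_control \<epsilon> T u0 g \<longrightarrow> L2_norm {0<..<T} f \<le> L2_norm {0<..<T} g)"

text \<open>
  The norm of a null control of minimal norm, as an infimum in \<open>[0,\<infinity>]\<close>; the lemma below
  shows that it is the norm of any minimal control.
\<close>

definition minimal_control_norm :: "real \<Rightarrow> real \<Rightarrow> (real \<Rightarrow> real) \<Rightarrow> ennreal" where
  "minimal_control_norm \<epsilon> T u0 =
     (INF f\<in>{f. null_control \<epsilon> T u0 f}. ennreal (L2_norm {0<..<T} f))"

lemma minimal_control_norm_eq:
  assumes "minimal_null_control \<epsilon> T u0 f"
  shows "minimal_control_norm \<epsilon> T u0 = ennreal (L2_norm {0<..<T} f)"
  unfolding minimal_control_norm_def
proof (rule antisym)
  show "(INF f\<in>{f. null_control \<epsilon> T u0 f}. ennreal (L2_norm {0<..<T} f))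
          \<le> ennreal (L2_norm {0<..<T} f)"
    using assms by (intro INF_lower) (simp add: minimal_null_control_def)
  show "ennreal (L2_norm {0<..<T} f)
          \<le> (INF f\<in>{f. null_control \<epsilon> T u0 f}. ennreal (L2_norm {0<..<T} f))"
    using assms by (intro INF_greatest ennreal_leI) (simp add: minimal_null_control_def)
qed

text \<open>The cost \<open>C\<^sub>\<epsilon>(T,1,-1)\<close>: interval of length \<open>1\<close>, transport speed \<open>-1\<close>.\<close>

definition control_cost :: "real \<Rightarrow> real \<Rightarrow> ennreal" where
  "control_cost \<epsilon> T =
     (SUP u0\<in>{u0 \<in> L2 {0<..<1}. L2_norm {0<..<1} u0 \<le> 1}. minimal_control_norm \<epsilon> T u0)"

end

theory Submission
  imports Defs
begin

text \<open>
  Put \<open>\<lambda>\<^sub>k = 1/(4\<epsilon>) + \<epsilon>k\<^sup>2\<pi>\<^sup>2\<close>. The functions \<open>e\<^bsup>-\<lambda>\<^sub>kt\<^esup> e\<^bsup>x/(2\<epsilon>)\<^esup> sin(k\<pi>x)\<close> solve the adjoint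
  problem, and their traces \<open>\<partial>\<^sub>xz(t,0)\<close> are multiples of \<open>e\<^bsup>-\<lambda>\<^sub>kt\<^esup>\<close>. The solution is sought as a
  finite sum of the first \<open>N\<close> of them whose trace is as small as possible compared with its first
  coefficient.

  On the half line this is the problem of Muntz: in \<open>L\<^sup>2(0,\<infinity>)\<close> the distance from
  \<open>e\<^bsup>-\<lambda>\<^sub>1t\<^esup>\<close> to the span of the other exponentials is
  \<open>(2\<lambda>\<^sub>1)\<^bsup>-1/2\<^esup> \<Prod>\<^bsub>2\<le>j\<le>N\<^esub> (\<lambda>\<^sub>j - \<lambda>\<^sub>1)/(\<lambda>\<^sub>j + \<lambda>\<^sub>1)\<close>, and the optimal coefficients \<open>b\<^sub>k\<close> are the residues of
  the rational function \<open>\<Prod>\<^bsub>2\<le>j\<le>N\<^esub> (\<lambda>\<^sub>j - s) / \<Prod>\<^bsub>1\<le>j\<le>N\<^esub> (s + \<lambda>\<^sub>j)\<close>, which is the Laplace transform of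
  the trace. Its zeros at \<open>\<lambda>\<^sub>2, \<dots>, \<lambda>\<^sub>N\<close> say that the trace is orthogonal to all exponentials but
  the first, so that its energy is exactly \<open>1/(2\<lambda>\<^sub>1)\<close> (\<open>muntz_coeff_energy\<close>). On the other hand
  \<open>b\<^sub>1 = \<Prod>\<^bsub>2\<le>j\<le>N\<^esub> (\<lambda>\<^sub>j + \<lambda>\<^sub>1)/(\<lambda>\<^sub>j - \<lambda>\<^sub>1)\<close> dominates, up to the factor for \<open>j = 1\<close>, a truncation of
  \<open>\<Prod>\<^sub>j (1 + a\<^sup>2/j\<^sup>2) = sinh(\<pi>a)/(\<pi>a)\<close> with \<open>a\<^sup>2 = 1 + 1/(2\<pi>\<^sup>2\<epsilon>\<^sup>2)\<close>. Since \<open>\<pi>a\<close> is about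
  \<open>1/(\<surd>2 \<epsilon>)\<close>, for \<open>N\<close> large \<open>b\<^sub>1\<^sup>2\<close> is at least a multiple of \<open>\<epsilon>\<^sup>6 e\<^bsup>\<surd>2/\<epsilon>\<^esup>\<close>
  (\<open>exists_muntz_coeff_first_ge\<close>).

  It remains to see that the higher modes do not destroy the final state. The residues have
  alternating signs, and so have the integrals of \<open>e\<^bsup>x/(2\<epsilon>)\<^esup>\<close> against the eigenmodes, because these
  integrals are governed by the endpoint \<open>x = 1\<close>. Hence all modes contribute with the same sign to
  the pairing of \<open>z(T)\<close> with \<open>e\<^bsup>x/(2\<epsilon>)\<^esup>\<close>, the first mode alone bounds this pairing from below, and
  Cauchy-Schwarz gives \<open>\<parallel>z(T)\<parallel>\<^sup>2 \<ge> c \<epsilon>\<^sup>3 b\<^sub>1\<^sup>2 e\<^bsup>(2-T)/(2\<epsilon>)\<^esup>\<close>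
  (\<open>L2_norm_alternating_mode_sum_ge\<close>). The trace term satisfies
  \<open>\<parallel>\<epsilon> \<partial>\<^sub>xz(\<cdot>,0)\<parallel>\<^sup>2 \<le> \<epsilon>\<^sup>2/(2\<lambda>\<^sub>1) \<le> 2\<epsilon>\<^sup>3\<close>, and the exponents add up to \<open>(2 + 2\<surd>2 - T)/(2\<epsilon>)\<close>.

  The bound on the cost follows by duality: testing the transposition identity for a null control
  of the normalised datum \<open>z(T)/\<parallel>z(T)\<parallel>\<close> with the time-reversed solution shows that the control has
  norm at least \<open>\<parallel>z(T)\<parallel> / \<parallel>\<epsilon> \<partial>\<^sub>xz(\<cdot>,0)\<parallel>\<close> (\<open>control_cost_ge\<close>).
\<close>

section \<open>Square-integrable functions on an interval\<close>

text \<open>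
  Transfers set integrals over open intervals, in which the norms are expressed, to gauge integrals
  over closed ones, for which the fundamental theorem of calculus is available.
\<close>

lemma lborel_integral_continuous:
  fixes f :: "real \<Rightarrow> real"
  assumes "continuous_on {a..b} f"
  shows "set_integrable lborel {a<..<b} f"
    and "(LBINT x:{a<..<b}. f x) = integral {a..b} f"
proof -
  have "set_integrable lborel {a..b} f"
    using assms by (rule borel_integrable_atLeastAtMost')
  then show int: "set_integrable lborel {a<..<b} f"
    by (rule set_integrable_subset) auto
  show "(LBINT x:{a<..<b}. f x) = integral {a..b} f"
    using set_borel_integral_eq_integral(2)[OF int] by (simp add: integral_open_interval_real)
qed

lemma L2_continuous_on:
  assumes "continuous_on {a..b} v"
  shows "v \<in> L2 {a<..<b}"
proof -
  have "set_integrable lborel {a<..<b} v"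
    using assms by (rule lborel_integral_continuous)
  moreover have "set_integrable lborel {a<..<b} (\<lambda>x. (v x)\<^sup>2)"
    using assms by (intro lborel_integral_continuous continuous_intros)
  ultimately show ?thesis
    unfolding L2_def set_borel_measurable_def
    using borel_measurable_integrable by (auto simp: set_integrable_def)
qed

lemma L2_norm_nonneg: "0 \<le> L2_norm S v"
  unfolding L2_norm_def set_lebesgue_integral_def
  by (intro real_sqrt_ge_zero integral_nonneg_AE) (auto simp: indicator_def)

lemma L2_norm_power2: "(L2_norm S v)\<^sup>2 = (LBINT x:S. (v x)\<^sup>2)"
proof -
  have "0 \<le> (LBINT x:S. (v x)\<^sup>2)"
    unfolding set_lebesgue_integral_def
    by (intro integral_nonneg_AE) (auto simp: indicator_def)
  then show ?thesis by (simp add: L2_norm_def)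
qed

lemma L2_norm_power2_continuous:
  assumes "continuous_on {a..b} v"
  shows "(L2_norm {a<..<b} v)\<^sup>2 = integral {a..b} (\<lambda>x. (v x)\<^sup>2)"
  unfolding L2_norm_power2 using assms
  by (intro lborel_integral_continuous continuous_intros)

lemma L2_norm_scale: "L2_norm S (\<lambda>x. c * v x) = \<bar>c\<bar> * L2_norm S v"
  by (simp add: L2_norm_def power_mult_distrib real_sqrt_mult)

lemma L2_scale: "v \<in> L2 S \<Longrightarrow> (\<lambda>x. c * v x) \<in> L2 S"
  unfolding L2_def set_borel_measurable_def
  by (auto simp: mult.left_commute[of _ c] power_mult_distrib)

lemma L2_norm_le:
  assumes "continuous_on {0..1} v" and "\<And>x. x \<in> {0..1} \<Longrightarrow> \<bar>v x\<bar> \<le> M"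
  shows "L2_norm {0<..<1} v \<le> M"
proof -
  have "0 \<le> M" using assms(2)[of 0] by auto
  have "integral {0..1} (\<lambda>x. (v x)\<^sup>2) \<le> integral {0..1} (\<lambda>x::real. M\<^sup>2)"
  proof (rule Henstock_Kurzweil_Integration.integral_le)
    show "(\<lambda>x. (v x)\<^sup>2) integrable_on {0..1}"
      using assms(1) by (intro integrable_continuous_real continuous_intros)
    show "(v x)\<^sup>2 \<le> M\<^sup>2" if "x \<in> {0..1}" for x
      using assms(2)[OF that] \<open>0 \<le> M\<close> by (simp add: abs_le_square_iff[symmetric])
  qed auto
  then have "(L2_norm {0<..<1} v)\<^sup>2 \<le> M\<^sup>2"
    using L2_norm_power2_continuous[OF assms(1)] by simp
  then show ?thesis using \<open>0 \<le> M\<close> by (rule power2_le_imp_le)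
qed

text \<open>
  The quadratic polynomial \<open>r \<mapsto> \<parallel>f - r g\<parallel>\<^sup>2\<close> is nonnegative, so its discriminant is not positive.
\<close>

lemma L2_Cauchy_Schwarz:
  assumes f: "f \<in> L2 S" and g: "g \<in> L2 S"
  shows "\<bar>LBINT x:S. f x * g x\<bar> \<le> L2_norm S f * L2_norm S g"
proof -
  define A B I where "A = (LBINT x:S. (f x)\<^sup>2)" and "B = (LBINT x:S. (g x)\<^sup>2)"
    and "I = (LBINT x:S. f x * g x)"
  have ff: "set_integrable lborel S (\<lambda>x. (f x)\<^sup>2)" and gg: "set_integrable lborel S (\<lambda>x. (g x)\<^sup>2)"
    using f g by (auto simp: L2_def)
  have "set_borel_measurable lborel S (\<lambda>x. f x * g x)"
  proof -
    have "(\<lambda>x. (indicator S x *\<^sub>R f x) * (indicator S x *\<^sub>R g x)) \<in> borel_measurable lborel"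
      using f g unfolding L2_def set_borel_measurable_def by (intro borel_measurable_times) auto
    also have "(\<lambda>x. (indicator S x *\<^sub>R f x) * (indicator S x *\<^sub>R g x))
        = (\<lambda>x. indicator S x *\<^sub>R (f x * g x))"
      by (auto simp: indicator_def)
    finally show ?thesis by (simp add: set_borel_measurable_def)
  qed
  moreover have "norm (indicat_real S x *\<^sub>R (f x * g x))
      \<le> norm (indicat_real S x *\<^sub>R ((f x)\<^sup>2 + (g x)\<^sup>2))" for x
  proof -
    have "\<bar>f x * g x\<bar> \<le> (f x)\<^sup>2 + (g x)\<^sup>2"
      using sum_squares_bound[of "\<bar>f x\<bar>" "\<bar>g x\<bar>"] mult_nonneg_nonneg[of "\<bar>f x\<bar>" "\<bar>g x\<bar>"]
      unfolding abs_mult power2_abs by linarith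
    then show ?thesis by (auto simp: indicator_def)
  qed
  ultimately have fg: "set_integrable lborel S (\<lambda>x. f x * g x)"
    using Bochner_Integration.integrable_bound[OF
        set_integral_add(1)[OF ff gg, unfolded set_integrable_def]]
    unfolding set_integrable_def set_borel_measurable_def by blast
  have quad: "0 \<le> A - 2 * r * I + r\<^sup>2 * B" for r
  proof -
    have "0 \<le> (LBINT x:S. (f x - r * g x)\<^sup>2)"
      unfolding set_lebesgue_integral_def
      by (intro integral_nonneg_AE) (auto simp: indicator_def)
    also have "\<dots> = (LBINT x:S. ((f x)\<^sup>2 - (2 * r) * (f x * g x)) + r\<^sup>2 * (g x)\<^sup>2)"
      by (simp add: power2_eq_square algebra_simps)
    also have "\<dots> = A - 2 * r * I + r\<^sup>2 * B"
    proof -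
      have 1: "set_integrable lborel S (\<lambda>x. (2 * r) * (f x * g x))"
        and 2: "set_integrable lborel S (\<lambda>x. r\<^sup>2 * (g x)\<^sup>2)"
        using fg gg by (auto intro!: set_integrable_mult_right)
      show ?thesis
        unfolding A_def B_def I_def
        by (subst set_integral_add(2)[OF set_integral_diff(1)[OF ff 1] 2],
          subst set_integral_diff(2)[OF ff 1]) simp
    qed
    finally show ?thesis .
  qed
  have "I\<^sup>2 \<le> A * B"
  proof (cases "B = 0")
    case False
    moreover have "0 \<le> B" unfolding B_def L2_norm_power2[symmetric] by simp
    ultimately have "B > 0" by simp
    \<comment> \<open>The minimiser of the quadratic polynomial is \<open>r = I / B\<close>.\<close>
    have "0 \<le> A - 2 * (I / B) * I + (I / B)\<^sup>2 * B" by (rule quad)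
    also have "\<dots> = (A * B - I\<^sup>2) / B" using \<open>B > 0\<close> by (simp add: field_simps power2_eq_square)
    finally show ?thesis using \<open>B > 0\<close> by (simp add: zero_le_divide_iff)
  next
    case True
    have "I = 0"
    proof (rule ccontr)
      assume "I \<noteq> 0"
      \<comment> \<open>At this \<open>r\<close> the polynomial, which is affine when \<open>B = 0\<close>, takes the value \<open>-1\<close>.\<close>
      then show False using quad[of "(A + 1) / (2 * I)"] True by simp
    qed
    then show ?thesis using True by simp
  qed
  then have "\<bar>I\<bar>\<^sup>2 \<le> (L2_norm S f * L2_norm S g)\<^sup>2"
    by (simp add: power_mult_distrib L2_norm_power2 A_def B_def)
  then show ?thesis
    unfolding I_def by (rule power2_le_imp_le) (simp add: L2_norm_nonneg)
qed

lemma L2_norm_reflect: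
  "L2_norm {0<..<T} (\<lambda>t. v (T - t)) = L2_norm {0<..<T} v"
proof -
  have "(LBINT t:{0<..<T}. (v (T - t))\<^sup>2)
      = (\<integral>t. indicat_real {0<..<T} (T - t) *\<^sub>R (v (T - t))\<^sup>2 \<partial>lborel)"
    unfolding set_lebesgue_integral_def
    by (intro Bochner_Integration.integral_cong) (auto simp: indicator_def)
  also have "\<dots> = (LBINT t:{0<..<T}. (v t)\<^sup>2)"
    unfolding set_lebesgue_integral_def
    using lborel_integral_real_affine[of "-1" "\<lambda>t. indicat_real {0<..<T} t *\<^sub>R (v t)\<^sup>2" T] by simp
  finally show ?thesis by (simp add: L2_norm_def)
qed

section \<open>Weak derivatives\<close>

text \<open>
  Integration by parts: the boundary terms vanish because test functions are supported in a compact
  subset of the open interval.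
\<close>

lemma has_weak_deriv_C1:
  assumes der: "\<And>x. (v has_real_derivative g x) (at x)" and g: "continuous_on UNIV g"
  shows "has_weak_deriv v g"
proof -
  have cv: "continuous_on A v" for A
    using der by (meson DERIV_continuous_on has_field_derivative_at_within)
  have cg: "continuous_on A g" for A using g by (rule continuous_on_subset) auto
  have "(LBINT x:{0<..<1}. v x * deriv \<psi> x) = - (LBINT x:{0<..<1}. g x * \<psi> x)"
    if \<psi>: "test_function \<psi>" for \<psi>
  proof -
    have d0: "\<psi> differentiable_on UNIV" and d1: "deriv \<psi> differentiable_on UNIV"
      using \<psi> unfolding test_function_def
      by (metis funpow_0, metis One_nat_def funpow_0 funpow_simps_right(2) comp_apply)
    have ends: "\<psi> 0 = 0" "\<psi> 1 = 0" using \<psi> unfolding test_function_def by force+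
    have D: "(\<psi> has_real_derivative deriv \<psi> x) (at x)" for x
      using d0 by (meson DERIV_deriv_iff_real_differentiable differentiable_on_def
          UNIV_I real_differentiableE differentiable_at_withinI field_differentiable_def real_differentiable_def)
    have cd: "continuous_on A (deriv \<psi>)" for A
      using differentiable_imp_continuous_on[OF d1] by (rule continuous_on_subset) auto
    have c\<psi>: "continuous_on A \<psi>" for A
      using differentiable_imp_continuous_on[OF d0] by (rule continuous_on_subset) auto
    have "((\<lambda>x. v x * deriv \<psi> x + g x * \<psi> x) has_integral (v 1 * \<psi> 1 - v 0 * \<psi> 0)) {0..1}"
    proof (rule fundamental_theorem_of_calculus)
      fix x :: real
      have "((\<lambda>x. v x * \<psi> x) has_real_derivative (v x * deriv \<psi> x + g x * \<psi> x)) (at x)"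
        by (rule derivative_eq_intros der D refl)+ simp
      then show "((\<lambda>x. v x * \<psi> x) has_vector_derivative (v x * deriv \<psi> x + g x * \<psi> x))
          (at x within {0..1})"
        by (simp add: has_real_derivative_iff_has_vector_derivative has_vector_derivative_at_within)
    qed simp
    then have "integral {0..1} (\<lambda>x. v x * deriv \<psi> x + g x * \<psi> x) = 0"
      using ends by (simp add: integral_unique)
    then have "integral {0..1} (\<lambda>x. v x * deriv \<psi> x) + integral {0..1} (\<lambda>x. g x * \<psi> x) = 0"
      by (subst (asm) Henstock_Kurzweil_Integration.integral_add)
        (intro integrable_continuous_real continuous_intros cv cg cd c\<psi>)+
    moreover have "(LBINT x:{0<..<1}. v x * deriv \<psi> x) = integral {0..1} (\<lambda>x. v x * deriv \<psi> x)"
      "(LBINT x:{0<..<1}. g x * \<psi> x) = integral {0..1} (\<lambda>x. g x * \<psi> x)"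
      by (intro lborel_integral_continuous continuous_intros cv cg cd c\<psi>)+
    ultimately show ?thesis by simp
  qed
  then show ?thesis
    unfolding has_weak_deriv_def using L2_continuous_on[OF cv] L2_continuous_on[OF cg] by blast
qed

section \<open>Finite sums of eigenmodes\<close>

text \<open>
  For finite sums with separated variables, convergence of the coefficients implies convergence in
  \<open>L\<^sup>2\<close>, because the spatial factors are bounded on \<open>[0,1]\<close>. This yields every continuity and
  differentiability in time that the notion of adjoint solution asks for.
\<close>

lemma L2_norm_sum_tendsto_0:
  fixes \<alpha> :: "'i \<Rightarrow> real \<Rightarrow> real"
  assumes \<alpha>: "\<And>k. k \<in> I \<Longrightarrow> (\<alpha> k \<longlongrightarrow> 0) F" and \<phi>: "\<And>k. k \<in> I \<Longrightarrow> continuous_on {0..1} (\<phi> k)"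
  shows "((\<lambda>s. L2_norm {0<..<1} (\<lambda>x. \<Sum>k\<in>I. \<alpha> k s * \<phi> k x)) \<longlongrightarrow> 0) F"
proof -
  have "\<exists>M. \<forall>x\<in>{0..1}. \<bar>\<phi> k x\<bar> \<le> M" if "k \<in> I" for k
    using compact_imp_bounded[OF compact_continuous_image[OF \<phi>[OF that]]]
    by (auto simp: bounded_iff)
  then obtain M where M: "\<And>k x. k \<in> I \<Longrightarrow> x \<in> {0..1} \<Longrightarrow> \<bar>\<phi> k x\<bar> \<le> M k"
    by metis
  have bound: "L2_norm {0<..<1} (\<lambda>x. \<Sum>k\<in>I. \<alpha> k s * \<phi> k x) \<le> (\<Sum>k\<in>I. \<bar>\<alpha> k s\<bar> * M k)" for s
  proof (rule L2_norm_le)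
    show "continuous_on {0..1} (\<lambda>x. \<Sum>k\<in>I. \<alpha> k s * \<phi> k x)"
      by (intro continuous_intros \<phi>)
    show "\<bar>\<Sum>k\<in>I. \<alpha> k s * \<phi> k x\<bar> \<le> (\<Sum>k\<in>I. \<bar>\<alpha> k s\<bar> * M k)" if "x \<in> {0..1}" for x
      by (rule order_trans[OF sum_abs]) (auto simp: abs_mult intro!: sum_mono mult_left_mono M that)
  qed
  have "((\<lambda>s. \<Sum>k\<in>I. \<bar>\<alpha> k s\<bar> * M k) \<longlongrightarrow> (\<Sum>k\<in>I. \<bar>0\<bar> * M k)) F"
    by (intro tendsto_intros \<alpha>)
  then have lim: "((\<lambda>s. \<Sum>k\<in>I. \<bar>\<alpha> k s\<bar> * M k) \<longlongrightarrow> 0) F" by simp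
  show ?thesis
    by (rule tendsto_sandwich[OF _ _ tendsto_const lim])
      (simp_all only: L2_norm_nonneg bound eventually_True)
qed

lemma L2_continuous_sum:
  fixes \<alpha> :: "'i \<Rightarrow> real \<Rightarrow> real"
  assumes \<alpha>: "\<And>k. k \<in> I \<Longrightarrow> continuous_on UNIV (\<alpha> k)"
    and \<phi>: "\<And>k. k \<in> I \<Longrightarrow> continuous_on UNIV (\<phi> k)"
  shows "L2_continuous T (\<lambda>t x. \<Sum>k\<in>I. \<alpha> k t * \<phi> k x)"
  unfolding L2_continuous_def
proof
  fix t
  have "((\<lambda>s. L2_norm {0<..<1} (\<lambda>x. \<Sum>k\<in>I. (\<alpha> k s - \<alpha> k t) * \<phi> k x)) \<longlongrightarrow> 0) (at t within {0..T})"
  proof (rule L2_norm_sum_tendsto_0)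
    fix k assume k: "k \<in> I"
    have "(\<alpha> k \<longlongrightarrow> \<alpha> k t) (at t within {0..T})"
      using \<alpha>[OF k] continuous_on_subset[of UNIV] by (metis UNIV_I continuous_on_def subset_UNIV tendsto_within_subset)
    then show "((\<lambda>s. \<alpha> k s - \<alpha> k t) \<longlongrightarrow> 0) (at t within {0..T})"
      by (simp add: LIM_zero)
    show "continuous_on {0..1} (\<phi> k)"
      using \<phi>[OF k] by (rule continuous_on_subset) auto
  qed
  then show "((\<lambda>s. L2_norm {0<..<1} (\<lambda>x. (\<Sum>k\<in>I. \<alpha> k s * \<phi> k x) - (\<Sum>k\<in>I. \<alpha> k t * \<phi> k x)))
      \<longlongrightarrow> 0) (at t within {0..T})"
    by (simp add: left_diff_distrib sum_subtractf)
qed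

text \<open>
  An eigenfunction of \<open>\<phi> \<mapsto> - \<phi>' + \<epsilon> \<phi>''\<close> with Dirichlet conditions and eigenvalue \<open>-\<mu>\<close> gives the
  separated solution \<open>e\<^bsup>-\<mu>t\<^esup> \<phi>(x)\<close>. Finite sums of these are classical solutions, so the weak
  derivatives are the pointwise ones.
\<close>

lemma adjoint_solution_sum_eigenmodes:
  fixes \<mu> c :: "'i \<Rightarrow> real"
  assumes d1: "\<And>k x. k \<in> I \<Longrightarrow> (\<phi> k has_real_derivative \<phi>' k x) (at x)"
    and d2: "\<And>k x. k \<in> I \<Longrightarrow> (\<phi>' k has_real_derivative \<phi>'' k x) (at x)"
    and cont: "\<And>k. k \<in> I \<Longrightarrow> continuous_on UNIV (\<phi>'' k)"
    and bc: "\<And>k. k \<in> I \<Longrightarrow> \<phi> k 0 = 0" "\<And>k. k \<in> I \<Longrightarrow> \<phi> k 1 = 0"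
    and eig: "\<And>k x. k \<in> I \<Longrightarrow> - \<phi>' k x + \<epsilon> * \<phi>'' k x = - \<mu> k * \<phi> k x"
  shows "adjoint_solution \<epsilon> T (\<lambda>t x. \<Sum>k\<in>I. c k * exp (- \<mu> k * t) * \<phi> k x)"
    and "(\<lambda>x. \<Sum>k\<in>I. c k * exp (- \<mu> k * t) * \<phi> k x) \<in> H10 \<inter> H2"
proof -
  let ?a = "\<lambda>k t. c k * exp (- \<mu> k * t)"
  define z where "z = (\<lambda>t x. \<Sum>k\<in>I. ?a k t * \<phi> k x)"
  define z_x where "z_x = (\<lambda>t x. \<Sum>k\<in>I. ?a k t * \<phi>' k x)"
  define z_xx where "z_xx = (\<lambda>t x. \<Sum>k\<in>I. ?a k t * \<phi>'' k x)"
  define z_t where "z_t = (\<lambda>t x. \<Sum>k\<in>I. (- \<mu> k * ?a k t) * \<phi> k x)"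
  have c0: "continuous_on A (\<phi> k)" and c1: "continuous_on A (\<phi>' k)" if "k \<in> I" for A k
    by (rule DERIV_continuous_on[OF has_field_derivative_at_within[OF d1[OF that]]],
        rule DERIV_continuous_on[OF has_field_derivative_at_within[OF d2[OF that]]])
  have dz: "(z t has_real_derivative z_x t x) (at x)" for t x
    unfolding z_def z_x_def by (intro DERIV_sum DERIV_cmult d1)
  have dzx: "(z_x t has_real_derivative z_xx t x) (at x)" for t x
    unfolding z_xx_def z_x_def by (intro DERIV_sum DERIV_cmult d2)
  have cz: "continuous_on A (z t)" for A t
    unfolding z_def by (intro continuous_intros c0)
  have wz: "has_weak_deriv (z t) (z_x t)" for t
    by (rule has_weak_deriv_C1[OF dz]) (unfold z_x_def, intro continuous_intros c1)
  have wzx: "has_weak_deriv (z_x t) (z_xx t)" for t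
    by (rule has_weak_deriv_C1[OF dzx]) (unfold z_xx_def, intro continuous_intros cont)
  have H: "z t \<in> H10 \<inter> H2" for t
    using wz wzx cz bc by (auto simp: H10_def H1_def H2_def) (auto simp: z_def)
  then show "(\<lambda>x. \<Sum>k\<in>I. c k * exp (- \<mu> k * t) * \<phi> k x) \<in> H10 \<inter> H2"
    unfolding z_def .
  have L2t: "z_t t \<in> L2 {0<..<1}" for t
    unfolding z_t_def by (intro L2_continuous_on continuous_intros c0)
  have quot: "((\<lambda>s. L2_norm {0<..<1} (\<lambda>x. (z s x - z t x) / (s - t) - z_t t x)) \<longlongrightarrow> 0) (at t within {0..T})" for t
  proof -
    have "((\<lambda>s. L2_norm {0<..<1} (\<lambda>x. \<Sum>k\<in>I. ((?a k s - ?a k t) / (s - t) - (- \<mu> k * ?a k t)) * \<phi> k x))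
        \<longlongrightarrow> 0) (at t within {0..T})"
    proof (rule L2_norm_sum_tendsto_0[OF _ c0])
      fix k
      have "(?a k has_real_derivative (- \<mu> k * ?a k t)) (at t within {0..T})"
        by (auto intro!: derivative_eq_intros)
      then show "((\<lambda>s. (?a k s - ?a k t) / (s - t) - (- \<mu> k * ?a k t)) \<longlongrightarrow> 0) (at t within {0..T})"
        unfolding has_field_derivative_iff by (rule LIM_zero)
    qed
    moreover have "(\<Sum>k\<in>I. ((?a k s - ?a k t) / (s - t) - (- \<mu> k * ?a k t)) * \<phi> k x)
        = (z s x - z t x) / (s - t) - z_t t x" for s x
      by (simp add: z_def z_t_def sum_subtractf[symmetric] sum_divide_distrib)
        (simp add: sum.distrib[symmetric] left_diff_distrib distrib_right diff_divide_distrib)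
    ultimately show ?thesis by simp
  qed
  have eq: "z_t t x = - z_x t x + \<epsilon> * z_xx t x" for t x
  proof -
    have "z_t t x = (\<Sum>k\<in>I. ?a k t * (- \<mu> k * \<phi> k x))"
      unfolding z_t_def by (intro sum.cong refl) simp
    also have "\<dots> = (\<Sum>k\<in>I. ?a k t * (- \<phi>' k x + \<epsilon> * \<phi>'' k x))"
      by (intro sum.cong refl) (simp only: eig)
    also have "\<dots> = - z_x t x + \<epsilon> * z_xx t x"
      by (simp add: z_x_def z_xx_def distrib_left right_diff_distrib sum.distrib sum_subtractf sum_negf
          sum_distrib_left mult.left_commute)
    finally show ?thesis .
  qed
  have "L2_continuous T z" "L2_continuous T z_x" "L2_continuous T z_xx" "L2_continuous T z_t"
    unfolding z_def z_x_def z_xx_def z_t_def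
    by (intro L2_continuous_sum continuous_intros c0 c1 cont; assumption)+
  then show "adjoint_solution \<epsilon> T (\<lambda>t x. \<Sum>k\<in>I. c k * exp (- \<mu> k * t) * \<phi> k x)"
    unfolding adjoint_solution_def z_def[symmetric]
    using H wz wzx L2t quot eq by (intro exI[of _ z_t] exI[of _ z_x] exI[of _ z_xx]) auto
qed

lemma left_trace_deriv_eq:
  assumes "(v has_real_derivative d) (at 0)"
  shows "left_trace_deriv v = d"
  unfolding left_trace_deriv_def
proof (rule vector_derivative_within_closed_interval)
  show "(v has_vector_derivative d) (at 0 within {0..1})"
    using assms by (simp add: has_real_derivative_iff_has_vector_derivative has_vector_derivative_at_within)
qed auto

section \<open>Observability bounds the control cost from below\<close>

text \<open>
  Duality between controllability and observability. If \<open>f\<close> is a null control of \<open>u0\<close>, then testing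
  with the time reversal of \<open>z\<close> gives \<open>\<langle>u0, z(T)\<rangle> = - \<epsilon> \<integral> f(t) \<partial>\<^sub>xz(T - t, 0) dt\<close>; the datum
  \<open>u0 = z(T)/\<parallel>z(T)\<parallel>\<close> makes the left-hand side as large as possible. If there is no null control, the
  infimum that defines the minimal norm is \<open>\<infinity>\<close> and the bound holds trivially.
\<close>

lemma control_cost_ge:
  assumes sol: "adjoint_solution \<epsilon> T z" and T: "0 \<le> T"
    and cont: "continuous_on {0..T} (\<lambda>t. left_trace_deriv (z t))"
    and D: "0 < L2_norm {0<..<T} (\<lambda>t. \<epsilon> * left_trace_deriv (z t))"
  shows "ennreal (L2_norm {0<..<1} (z T) / L2_norm {0<..<T} (\<lambda>t. \<epsilon> * left_trace_deriv (z t)))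
    \<le> control_cost \<epsilon> T"
proof (cases "L2_norm {0<..<1} (z T) = 0")
  case False
  define n where "n = L2_norm {0<..<1} (z T)"
  define D where "D = L2_norm {0<..<T} (\<lambda>t. \<epsilon> * left_trace_deriv (z t))"
  have "n > 0" using False L2_norm_nonneg[of "{0<..<1}" "z T"] by (simp add: n_def)
  define u0 where "u0 x = (1 / n) * z T x" for x
  have z0: "z 0 \<in> H10" and zT: "z T \<in> L2 {0<..<1}"
    using sol T unfolding adjoint_solution_def has_weak_deriv_def by force+
  have u0_L2: "u0 \<in> L2 {0<..<1}"
    using zT unfolding u0_def by (rule L2_scale)
  have u0_norm: "L2_norm {0<..<1} u0 \<le> 1"
    using \<open>n > 0\<close> unfolding u0_def L2_norm_scale by (simp add: n_def)
  have "n / D \<le> L2_norm {0<..<T} f" if nc: "null_control \<epsilon> T u0 f" for f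
  proof -
    obtain u where f: "f \<in> L2 {0<..<T}" and u: "transposition_solution \<epsilon> T u0 f u"
      and uT: "\<And>v. v \<in> H10 \<Longrightarrow> u T v = 0"
      using nc unfolding null_control_def by blast
    \<comment> \<open>The test function is \<open>\<phi>(t) = z(T - t)\<close> on the whole interval, so that \<open>\<phi>(T) = z(0)\<close> and \<open>\<phi>(0) = z(T)\<close>.\<close>
    have "u T (z (T - T)) = (LBINT x:{0<..<1}. u0 x * z (T - 0) x)
        + \<epsilon> * (LBINT t:{0<..<T}. f t * left_trace_deriv (z (T - t)))"
    proof -
      have "adjoint_solution \<epsilon> T (\<lambda>t. z (T - (T - t)))" using sol by simp
      then show ?thesis
        using u T unfolding transposition_solution_def
        by (elim conjE ballE[of _ _ T]) (auto elim!: allE[of _ "\<lambda>t. z (T - t)"])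
    qed
    moreover have "(LBINT x:{0<..<1}. u0 x * z T x) = n"
    proof -
      have "(LBINT x:{0<..<1}. u0 x * z T x) = (LBINT x:{0<..<1}. (1 / n) * (z T x)\<^sup>2)"
        by (simp add: u0_def power2_eq_square)
      also have "\<dots> = (1 / n) * n\<^sup>2"
        unfolding n_def L2_norm_power2 by (rule set_integral_mult_right)
      finally show ?thesis using \<open>n > 0\<close> by (simp add: power2_eq_square)
    qed
    ultimately have "n = - \<epsilon> * (LBINT t:{0<..<T}. f t * left_trace_deriv (z (T - t)))"
      using uT[OF z0] by simp
    also have "\<dots> = - (LBINT t:{0<..<T}. \<epsilon> * (f t * left_trace_deriv (z (T - t))))"
      by (subst set_integral_mult_right) simp
    also have "\<dots> = - (LBINT t:{0<..<T}. f t * (\<epsilon> * left_trace_deriv (z (T - t))))"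
      by (simp add: mult.left_commute)
    also have "\<dots> \<le> L2_norm {0<..<T} f * L2_norm {0<..<T} (\<lambda>t. \<epsilon> * left_trace_deriv (z (T - t)))"
    proof -
      have "continuous_on {0..T} (\<lambda>t. left_trace_deriv (z (T - t)))"
        by (rule continuous_on_compose2[OF cont]) (auto intro!: continuous_intros)
      then have "(\<lambda>t. \<epsilon> * left_trace_deriv (z (T - t))) \<in> L2 {0<..<T}"
        by (intro L2_continuous_on continuous_intros)
      from L2_Cauchy_Schwarz[OF f this] show ?thesis by linarith
    qed
    also have "L2_norm {0<..<T} (\<lambda>t. \<epsilon> * left_trace_deriv (z (T - t))) = D"
      unfolding D_def by (rule L2_norm_reflect)
    finally show ?thesis using assms(4) by (simp add: D_def field_simps)
  qed
  then have "ennreal (n / D) \<le> minimal_control_norm \<epsilon> T u0"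
    unfolding minimal_control_norm_def by (intro INF_greatest ennreal_leI) auto
  also have "\<dots> \<le> control_cost \<epsilon> T"
    unfolding control_cost_def using u0_L2 u0_norm by (intro SUP_upper) auto
  finally show ?thesis unfolding n_def D_def .
qed simp

section \<open>Exponential sums of least energy\<close>

lemma lagrange_interpolation:
  fixes x :: "'i \<Rightarrow> 'a :: field"
  assumes fin: "finite I" and inj: "inj_on x I" and deg: "degree p < card I"
  shows "poly p s = (\<Sum>k\<in>I. poly p (x k) * (\<Prod>j\<in>I-{k}. s - x j) / (\<Prod>j\<in>I-{k}. x k - x j))"
proof -
  define w where "w k = (\<Prod>j\<in>I-{k}. x k - x j)" for k
  define q where "q = (\<Sum>k\<in>I. smult (poly p (x k) / w k) (\<Prod>j\<in>I-{k}. [:- x j, 1:]))"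
  have poly_q: "poly q s = (\<Sum>k\<in>I. poly p (x k) * (\<Prod>j\<in>I-{k}. s - x j) / w k)" for s
    by (simp add: q_def poly_sum poly_prod)
  have w: "w k \<noteq> 0" if "k \<in> I" for k
    using that inj fin by (auto simp: w_def inj_on_def)
  have "p = q"
  proof (rule poly_eqI_degree[where A = "x ` I"])
    fix y assume "y \<in> x ` I"
    then obtain m where m: "m \<in> I" "y = x m" by auto
    have "poly q y = (\<Sum>k\<in>I. if k = m then poly p (x m) else 0)"
      unfolding poly_q
    proof (rule sum.cong[OF refl])
      fix k assume k: "k \<in> I"
      show "poly p (x k) * (\<Prod>j\<in>I-{k}. y - x j) / w k = (if k = m then poly p (x m) else 0)"
      proof (cases "k = m")
        case True
        then show ?thesis using w[OF m(1)] by (simp add: m w_def)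
      next
        case False
        then have "(\<Prod>j\<in>I-{k}. y - x j) = 0" using fin m by (intro prod_zero) auto
        then show ?thesis using False by simp
      qed
    qed
    then show "poly p y = poly q y" using m fin by simp
  next
    show "degree p < card (x ` I)" using deg inj by (simp add: card_image)
    have "degree q \<le> card I - 1"
      unfolding q_def
    proof (rule degree_sum_le[OF fin])
      fix k assume "k \<in> I"
      have "degree (\<Prod>j\<in>I-{k}. [:- x j, 1:]) \<le> sum (degree \<circ> (\<lambda>j. [:- x j, 1:])) (I-{k})"
        using fin by (intro degree_prod_sum_le) auto
      also have "\<dots> = card I - 1" using \<open>k \<in> I\<close> fin by (simp add: o_def)
      finally show "degree (smult (poly p (x k) / w k) (\<Prod>j\<in>I-{k}. [:- x j, 1:])) \<le> card I - 1"
        using degree_smult_le order_trans by blast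
    qed
    then show "degree q < card (x ` I)" using deg inj by (simp add: card_image)
  qed
  then show ?thesis using poly_q[of s] by (simp add: w_def)
qed

text \<open>
  The residue at \<open>- l k\<close> of \<open>\<Prod>\<^bsub>2\<le>j\<le>N\<^esub> (l j - s) / \<Prod>\<^bsub>1\<le>j\<le>N\<^esub> (s + l j)\<close>; up to a common factor, these are
  the coefficients of the exponential sum that realises the distance from \<open>e\<^bsup>-l\<^sub>1t\<^esup>\<close> to the span of
  the other exponentials in \<open>L\<^sup>2(0,\<infinity>)\<close>.
\<close>

definition muntz_coeff :: "nat \<Rightarrow> (nat \<Rightarrow> real) \<Rightarrow> nat \<Rightarrow> real" where
  "muntz_coeff N l k = (\<Prod>j\<in>{2..N}. l j + l k) / (\<Prod>j\<in>{1..N}-{k}. l j - l k)"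

text \<open>
  Lagrange interpolation of the numerator, whose degree is \<open>N - 1\<close>, at the \<open>N\<close> poles \<open>- l k\<close>.
\<close>

lemma muntz_coeff_partial_fractions:
  assumes inj: "inj_on l {1..N}" and N: "1 \<le> N" and s: "\<And>k. k \<in> {1..N} \<Longrightarrow> s + l k \<noteq> 0"
  shows "(\<Sum>k=1..N. muntz_coeff N l k / (s + l k)) = (\<Prod>j\<in>{2..N}. l j - s) / (\<Prod>j=1..N. s + l j)"
proof -
  define p where "p = (\<Prod>j\<in>{2..N}. [:l j, -1:])"
  have poly_p: "poly p y = (\<Prod>j\<in>{2..N}. l j - y)" for y
    by (simp add: p_def poly_prod)
  have "degree p \<le> sum (degree \<circ> (\<lambda>j. [:l j, -1:])) {2..N}"
    unfolding p_def by (intro degree_prod_sum_le) auto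
  also have "\<dots> < card {1..N}" using N by (simp add: o_def)
  finally have deg: "degree p < card {1..N}" .
  have "inj_on (\<lambda>k. - l k) {1..N}" by (intro inj_onI, rule inj_onD[OF inj]) auto
  from lagrange_interpolation[OF _ this deg, of s] have "poly p s = (\<Sum>k\<in>{1..N}. poly p (- l k) * (\<Prod>j\<in>{1..N}-{k}. s - (- l j))
      / (\<Prod>j\<in>{1..N}-{k}. - l k - (- l j)))"
    by simp
  also have "\<dots> = (\<Sum>k=1..N. muntz_coeff N l k / (s + l k) * (\<Prod>j=1..N. s + l j))"
  proof (rule sum.cong[OF refl])
    fix k assume k: "k \<in> {1..N}"
    have "(\<Prod>j=1..N. s + l j) = (s + l k) * (\<Prod>j\<in>{1..N}-{k}. s + l j)"
      using k by (intro prod.remove) auto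
    then show "poly p (- l k) * (\<Prod>j\<in>{1..N}-{k}. s - (- l j)) / (\<Prod>j\<in>{1..N}-{k}. - l k - (- l j))
        = muntz_coeff N l k / (s + l k) * (\<Prod>j=1..N. s + l j)"
      using s[OF k] by (simp add: poly_p muntz_coeff_def)
  qed
  also have "\<dots> = (\<Sum>k=1..N. muntz_coeff N l k / (s + l k)) * (\<Prod>j=1..N. s + l j)"
    by (simp add: sum_distrib_right)
  finally have "(\<Prod>j\<in>{2..N}. l j - s) = (\<Sum>k=1..N. muntz_coeff N l k / (s + l k)) * (\<Prod>j=1..N. s + l j)"
    by (simp add: poly_p)
  moreover have "(\<Prod>j=1..N. s + l j) \<noteq> 0" using s by simp
  ultimately show ?thesis by (simp add: field_simps)
qed

lemma muntz_coeff_first: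
  assumes "1 \<le> N"
  shows "muntz_coeff N l 1 = (\<Prod>j\<in>{2..N}. (l j + l 1) / (l j - l 1))"
proof -
  have "{1..N} - {1} = {2..N}" using assms by auto
  then show ?thesis by (simp add: muntz_coeff_def prod_dividef)
qed

text \<open>
  The double sum is the energy on \<open>(0,\<infinity>)\<close> of the exponential sum with coefficients \<open>muntz_coeff\<close>. Its
  inner sums are the values of the rational function at the points \<open>l j\<close>, and these vanish unless
  \<open>j = 1\<close>.
\<close>

lemma muntz_coeff_energy:
  assumes inj: "inj_on l {1..N}" and N: "1 \<le> N" and pos: "\<And>k. k \<in> {1..N} \<Longrightarrow> 0 < l k"
  shows "(\<Sum>j=1..N. \<Sum>k=1..N. muntz_coeff N l j * muntz_coeff N l k / (l j + l k)) = 1 / (2 * l 1)"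
proof -
  let ?b = "muntz_coeff N l"
  have R: "(\<Sum>k=1..N. ?b k / (l m + l k)) = (\<Prod>j\<in>{2..N}. l j - l m) / (\<Prod>j=1..N. l m + l j)"
    if "m \<in> {1..N}" for m
    using add_pos_pos[OF pos[OF that] pos]
    by (intro muntz_coeff_partial_fractions inj N) (use less_imp_neq in fastforce)
  have split: "{1..N} = insert 1 {2..N}" using N by auto
  have "(\<Sum>j=1..N. \<Sum>k=1..N. ?b j * ?b k / (l j + l k)) = (\<Sum>j=1..N. ?b j * (\<Sum>k=1..N. ?b k / (l j + l k)))"
    by (simp add: sum_distrib_left)
  also have "\<dots> = (\<Sum>j=1..N. ?b j * ((\<Prod>i\<in>{2..N}. l i - l j) / (\<Prod>i=1..N. l j + l i)))"
    by (intro sum.cong refl) (simp only: R)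
  also have "\<dots> = ?b 1 * ((\<Prod>i\<in>{2..N}. l i - l 1) / (\<Prod>i=1..N. l 1 + l i))"
  proof -
    have "(\<Sum>j\<in>{2..N}. ?b j * ((\<Prod>i\<in>{2..N}. l i - l j) / (\<Prod>i=1..N. l j + l i))) = 0"
    proof (intro sum.neutral ballI)
      fix j assume "j \<in> {2..N}"
      then have "(\<Prod>i\<in>{2..N}. l i - l j) = 0" by (intro prod_zero) auto
      then show "?b j * ((\<Prod>i\<in>{2..N}. l i - l j) / (\<Prod>i=1..N. l j + l i)) = 0" by simp
    qed
    then show ?thesis by (subst split) (simp add: split)
  qed
  also have "\<dots> = 1 / (2 * l 1)"
  proof -
    have "(\<Prod>i\<in>{2..N}. l i - l 1) \<noteq> 0"
      using inj N by (fastforce simp: inj_on_def)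
    moreover have "(\<Prod>i\<in>{2..N}. l i + l 1) \<noteq> 0"
    proof -
      have "0 < l i + l 1" if "i \<in> {2..N}" for i using that pos[of i] pos[of 1] N by auto
      then show ?thesis by force
    qed
    moreover have "(\<Prod>i=1..N. l 1 + l i) = 2 * l 1 * (\<Prod>i\<in>{2..N}. l i + l 1)"
      using split by (simp add: add.commute)
    ultimately show ?thesis
      using pos[of 1] N by (simp only: muntz_coeff_first[OF N] prod_dividef) (simp add: field_simps)
  qed
  finally show ?thesis .
qed

text \<open>
  The numerator is positive, and exactly \<open>k - 1\<close> factors of the denominator are negative.
\<close>

lemma muntz_coeff_sign:
  assumes mono: "strict_mono_on {1..N} l" and k: "k \<in> {1..N}" and pos: "\<And>j. j \<in> {1..N} \<Longrightarrow> 0 < l j"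
  shows "0 < (-1) ^ (k + 1) * muntz_coeff N l k"
proof -
  have split: "{1..N} - {k} = {1..<k} \<union> {k<..N}" using k by auto
  have "(\<Prod>j\<in>{1..N}-{k}. l j - l k) = (\<Prod>j\<in>{1..<k}. l j - l k) * (\<Prod>j\<in>{k<..N}. l j - l k)"
    unfolding split by (intro prod.union_disjoint) auto
  also have "(\<Prod>j\<in>{1..<k}. l j - l k) = (\<Prod>j\<in>{1..<k}. (-1) * (l k - l j))"
    by simp
  also have "\<dots> = (-1) ^ (k - 1) * (\<Prod>j\<in>{1..<k}. l k - l j)"
    by (subst prod.distrib) simp
  finally have "(\<Prod>j\<in>{1..N}-{k}. l j - l k)
      = (-1) ^ (k - 1) * ((\<Prod>j\<in>{1..<k}. l k - l j) * (\<Prod>j\<in>{k<..N}. l j - l k))"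
    by simp
  moreover have "0 < (\<Prod>j\<in>{1..<k}. l k - l j)" "0 < (\<Prod>j\<in>{k<..N}. l j - l k)"
    using k by (auto intro!: prod_pos strict_mono_onD[OF mono])
  ultimately obtain d where d: "(\<Prod>j\<in>{1..N}-{k}. l j - l k) = (-1) ^ (k - 1) * d" "0 < d"
    by (metis mult_pos_pos)
  have n: "0 < (\<Prod>j\<in>{2..N}. l j + l k)"
    using k pos by (intro prod_pos) (auto intro!: add_pos_pos)
  obtain m where m: "k = Suc m" using k by (cases k) auto
  have "(-1) ^ (k + 1) * muntz_coeff N l k
      = (-1) ^ (k + 1) * ((\<Prod>j\<in>{2..N}. l j + l k) / ((-1) ^ (k - 1) * d))"
    unfolding muntz_coeff_def d(1) ..
  also have "\<dots> = (\<Prod>j\<in>{2..N}. l j + l k) / d"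
    by (cases "even m") (simp_all add: m)
  finally have "(-1) ^ (k + 1) * muntz_coeff N l k = (\<Prod>j\<in>{2..N}. l j + l k) / d" .
  then show ?thesis using n d(2) by simp
qed

text \<open>
  The right-hand side is the energy on \<open>(0,\<infinity>)\<close>, hence the limit of the energies on \<open>(0,t)\<close>, which
  increase with \<open>t\<close>.
\<close>

lemma exponential_sum_energy_le:
  fixes b l :: "'i \<Rightarrow> real"
  assumes pos: "\<And>k. k \<in> I \<Longrightarrow> 0 < l k" and T: "0 \<le> T"
  shows "integral {0..T} (\<lambda>t. (\<Sum>k\<in>I. b k * exp (- l k * t))\<^sup>2) \<le> (\<Sum>j\<in>I. \<Sum>k\<in>I. b j * b k / (l j + l k))"
proof -
  define F where "F t = (\<Sum>j\<in>I. \<Sum>k\<in>I. b j * b k / (l j + l k) * (1 - exp (- (l j + l k) * t)))" for t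
  have D: "(F has_real_derivative (\<Sum>k\<in>I. b k * exp (- l k * t))\<^sup>2) (at t)" for t
  proof -
    have "(F has_real_derivative (\<Sum>j\<in>I. \<Sum>k\<in>I. b j * b k * exp (- (l j + l k) * t))) (at t)"
      unfolding F_def
    proof (intro DERIV_sum)
      fix j k assume "j \<in> I" "k \<in> I"
      then have "l j + l k > 0" using pos by (simp add: add_pos_pos)
      moreover have "((\<lambda>t. c * (1 - exp (- s * t))) has_real_derivative c * s * exp (- s * t)) (at t)"
        for c s :: real
        by (auto intro!: derivative_eq_intros)
      ultimately show "((\<lambda>t. b j * b k / (l j + l k) * (1 - exp (- (l j + l k) * t))) has_real_derivative
          b j * b k * exp (- (l j + l k) * t)) (at t)"
        by (metis less_irrefl nonzero_eq_divide_eq)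
    qed
    also have "(\<Sum>j\<in>I. \<Sum>k\<in>I. b j * b k * exp (- (l j + l k) * t)) = (\<Sum>k\<in>I. b k * exp (- l k * t))\<^sup>2"
      unfolding power2_eq_square sum_product
      by (intro sum.cong refl) (simp add: exp_add[symmetric] ring_distribs)
    finally show ?thesis .
  qed
  have "((\<lambda>t. (\<Sum>k\<in>I. b k * exp (- l k * t))\<^sup>2) has_integral F T - F 0) {0..T}"
    using T D by (intro fundamental_theorem_of_calculus)
      (auto simp: has_real_derivative_iff_has_vector_derivative[symmetric]
        intro: has_field_derivative_at_within)
  then have "integral {0..T} (\<lambda>t. (\<Sum>k\<in>I. b k * exp (- l k * t))\<^sup>2) = F T"
    by (simp add: integral_unique F_def)
  also have "F T \<le> (\<Sum>j\<in>I. \<Sum>k\<in>I. b j * b k / (l j + l k))"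
  proof (rule tendsto_lowerbound)
    have "((\<lambda>t. b j * b k / (l j + l k) * (1 - exp (- (l j + l k) * t))) \<longlongrightarrow> b j * b k / (l j + l k)) at_top"
      if "j \<in> I" "k \<in> I" for j k
    proof -
      have "l j + l k > 0" using pos that by (simp add: add_pos_pos)
      then have "((\<lambda>t. exp (- ((l j + l k) * t))) \<longlongrightarrow> 0) at_top"
        by (intro filterlim_compose[OF exp_at_bot] filterlim_compose[OF filterlim_uminus_at_bot_at_top]
            filterlim_tendsto_pos_mult_at_top[OF tendsto_const] filterlim_ident)
      then have "((\<lambda>t. b j * b k / (l j + l k) * (1 - exp (- (l j + l k) * t)))
          \<longlongrightarrow> b j * b k / (l j + l k) * (1 - 0)) at_top"
        by (intro tendsto_intros) (simp only: mult_minus_left)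
      then show ?thesis by simp
    qed
    then show "(F \<longlongrightarrow> (\<Sum>j\<in>I. \<Sum>k\<in>I. b j * b k / (l j + l k))) at_top"
      unfolding F_def by (intro tendsto_sum)
    have "F T \<le> F t" if "T \<le> t" for t
      using that by (rule DERIV_nonneg_imp_nondecreasing) (use D zero_le_power2 in blast)
    then show "\<forall>\<^sub>F t in at_top. F T \<le> F t"
      by (auto simp: eventually_at_top_linorder)
  qed simp
  finally show ?thesis .
qed

text \<open>
  Multiplication by \<open>e\<^bsup>l\<^sub>mt\<^esup>\<close> turns the term with index \<open>m\<close> into a constant, and differentiation
  removes it; the other coefficients are only multiplied by the nonzero numbers \<open>l m - l k\<close>.
\<close>

lemma exponentials_independent:
  fixes b l :: "'i \<Rightarrow> real"
  assumes "finite I" and "inj_on l I" and "u < v"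
    and "\<And>t. t \<in> {u<..<v} \<Longrightarrow> (\<Sum>k\<in>I. b k * exp (- l k * t)) = 0"
    and "k \<in> I"
  shows "b k = 0"
  using assms
proof (induction I arbitrary: b k rule: finite_induct)
  case (insert m I)
  have others: "b k = 0" if "k \<in> I" for k
  proof -
    define g where "g t = b m + (\<Sum>i\<in>I. b i * exp ((l m - l i) * t))" for t
    have e: "exp ((l m - l i) * t) = exp (l m * t) * exp (- l i * t)" for i t
      by (simp add: exp_add[symmetric] ring_distribs)
    have g0: "g t = 0" if "t \<in> {u<..<v}" for t
    proof -
      have "g t = exp (l m * t) * (\<Sum>i\<in>insert m I. b i * exp (- l i * t))"
        using insert.hyps
        by (simp add: g_def e sum_distrib_left distrib_left mult.left_commute[of "exp (l m * t)"]
            mult_exp_exp del: left_diff_distrib)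
      then show ?thesis using insert.prems(3)[OF that] by simp
    qed
    have "(\<Sum>i\<in>I. (b i * (l m - l i)) * exp (- l i * t)) = 0" if t: "t \<in> {u<..<v}" for t
    proof -
      have "(g has_real_derivative (\<Sum>i\<in>I. b i * (l m - l i) * exp ((l m - l i) * t))) (at t)"
        unfolding g_def by (auto intro!: derivative_eq_intros sum.cong)
      moreover have "(g has_real_derivative 0) (at t)"
        by (rule has_field_derivative_transform_within_open[where f = "\<lambda>_. 0" and S = "{u<..<v}"])
          (use t g0 in auto)
      ultimately have "(\<Sum>i\<in>I. b i * (l m - l i) * exp ((l m - l i) * t)) = 0"
        by (rule DERIV_unique)
      also have "(\<Sum>i\<in>I. b i * (l m - l i) * exp ((l m - l i) * t))
          = exp (l m * t) * (\<Sum>i\<in>I. (b i * (l m - l i)) * exp (- l i * t))"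
        unfolding sum_distrib_left
        by (intro sum.cong refl) (simp add: e)
      finally show ?thesis by simp
    qed
    with insert.prems(1,2) that have "b k * (l m - l k) = 0"
      by (intro insert.IH[of "\<lambda>i. b i * (l m - l i)" k]) auto
    moreover have "l m \<noteq> l k" using insert.prems(1) insert.hyps that by (auto dest: inj_onD)
    ultimately show ?thesis by simp
  qed
  have "(\<Sum>i\<in>I. b i * exp (- l i * ((u + v) / 2))) = 0"
    using others by (intro sum.neutral) auto
  then have "b m = 0"
    using insert.prems(3)[of "(u + v) / 2"] insert.prems(2) insert.hyps by auto
  then show ?case using others insert.prems(4) by auto
qed simp

section \<open>A truncated product for the hyperbolic sine\<close>

text \<open>
  Euler's product for the sine, evaluated at an imaginary argument. The factor \<open>2\<close> leaves room to stop
  at a finite stage.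
\<close>

lemma exists_prod_ge_sinh:
  fixes a :: real
  assumes "0 < a"
  shows "\<exists>N\<ge>1. sinh (pi * a) / (2 * (pi * a)) \<le> (\<Prod>j=1..N. 1 + a\<^sup>2 / (real j)\<^sup>2)"
proof -
  have "(\<lambda>n. Im (of_real pi * (\<i> * of_real a) * (\<Prod>j=1..n. 1 - (\<i> * of_real a)\<^sup>2 / (of_nat j)\<^sup>2)))
      \<longlonglongrightarrow> Im (sin (of_real pi * (\<i> * of_real a)))"
    by (intro tendsto_Im sin_product_formula_complex)
  also have "(\<lambda>n. Im (of_real pi * (\<i> * of_real a) * (\<Prod>j=1..n. 1 - (\<i> * of_real a)\<^sup>2 / (of_nat j)\<^sup>2)))
      = (\<lambda>n. pi * a * (\<Prod>j=1..n. 1 + a\<^sup>2 / (real j)\<^sup>2))"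
  proof
    fix n
    have "(\<Prod>j=1..n. 1 - (\<i> * complex_of_real a)\<^sup>2 / (of_nat j)\<^sup>2)
        = of_real (\<Prod>j=1..n. 1 + a\<^sup>2 / (real j)\<^sup>2)"
      by (simp add: power_mult_distrib)
    moreover have "Im (of_real pi * (\<i> * of_real a) * of_real P) = pi * a * P" for P
      by simp
    ultimately show "Im (of_real pi * (\<i> * of_real a) * (\<Prod>j=1..n. 1 - (\<i> * of_real a)\<^sup>2 / (of_nat j)\<^sup>2))
      = pi * a * (\<Prod>j=1..n. 1 + a\<^sup>2 / (real j)\<^sup>2)"
      by (simp only:)
  qed
  also have "Im (sin (of_real pi * (\<i> * of_real a))) = sinh (pi * a)"
    by (simp add: Im_sin sinh_def exp_minus field_simps)
  finally have lim: "(\<lambda>n. pi * a * (\<Prod>j=1..n. 1 + a\<^sup>2 / (real j)\<^sup>2)) \<longlonglongrightarrow> sinh (pi * a)" .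
  have "sinh (pi * a) / 2 < sinh (pi * a)" using assms by simp
  then have "\<forall>\<^sub>F n in sequentially. sinh (pi * a) / 2 < pi * a * (\<Prod>j=1..n. 1 + a\<^sup>2 / (real j)\<^sup>2)"
    by (rule order_tendstoD(1)[OF lim])
  then have "\<forall>\<^sub>F n in sequentially. n \<ge> 1 \<and> sinh (pi * a) / 2 < pi * a * (\<Prod>j=1..n. 1 + a\<^sup>2 / (real j)\<^sup>2)"
    using eventually_ge_at_top[of 1] by eventually_elim simp
  then obtain N where N: "N \<ge> 1" "sinh (pi * a) / 2 < pi * a * (\<Prod>j=1..N. 1 + a\<^sup>2 / (real j)\<^sup>2)"
    using eventually_happens'[OF sequentially_bot] by blast
  then show ?thesis using assms by (intro exI[of _ N]) (simp add: field_simps)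
qed

section \<open>Eigenmodes of the adjoint problem\<close>

text \<open>
  The conjugation \<open>z = e\<^bsup>x/(2\<epsilon>) - t/(4\<epsilon>)\<^esup> w\<close> turns the adjoint equation into the heat equation
  \<open>w\<^sub>t = \<epsilon> w\<^sub>x\<^sub>x\<close>. This explains the eigenmodes \<open>e\<^bsup>x/(2\<epsilon>)\<^esup> sin(k\<pi>x)\<close> and their rates of decay.
\<close>

definition decay :: "real \<Rightarrow> nat \<Rightarrow> real" where
  "decay \<epsilon> k = 1 / (4 * \<epsilon>) + \<epsilon> * (real k * pi)\<^sup>2"

definition mode :: "real \<Rightarrow> nat \<Rightarrow> real \<Rightarrow> real" where
  "mode \<epsilon> k x = exp (x / (2 * \<epsilon>)) * sin (real k * pi * x)"

lemma decay_pos: "0 < \<epsilon> \<Longrightarrow> 0 < decay \<epsilon> k"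
  unfolding decay_def by (intro add_pos_nonneg) auto

lemma strict_mono_decay:
  assumes "0 < \<epsilon>"
  shows "strict_mono_on A (decay \<epsilon>)"
proof (rule strict_mono_onI)
  fix r s :: nat assume "r < s"
  then show "decay \<epsilon> r < decay \<epsilon> s"
    using assms by (simp add: decay_def power_mult_distrib power_strict_mono)
qed

lemma continuous_on_mode: "continuous_on A (mode \<epsilon> k)"
  unfolding mode_def[abs_def] divide_inverse by (intro continuous_intros)

lemma mode_sum_adjoint_solution:
  assumes \<epsilon>: "0 < \<epsilon>"
  shows "adjoint_solution \<epsilon> T (\<lambda>t x. \<Sum>k\<in>I. c k * exp (- decay \<epsilon> k * t) * mode \<epsilon> k x)" (is ?sol)
    and "(\<lambda>x. \<Sum>k\<in>I. c k * exp (- decay \<epsilon> k * t) * mode \<epsilon> k x) \<in> H10 \<inter> H2" (is ?reg)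
    and "left_trace_deriv (\<lambda>x. \<Sum>k\<in>I. c k * exp (- decay \<epsilon> k * t) * mode \<epsilon> k x)
      = (\<Sum>k\<in>I. c k * (real k * pi) * exp (- decay \<epsilon> k * t))" (is ?trace)
proof -
  \<comment> \<open>The first and second derivatives of the eigenmode.\<close>
  define m1 where "m1 k x = exp (x / (2 * \<epsilon>)) * (sin (real k * pi * x) / (2 * \<epsilon>)
      + real k * pi * cos (real k * pi * x))" for k x
  define m2 where "m2 k x = exp (x / (2 * \<epsilon>)) * ((1 / (4 * \<epsilon>\<^sup>2) - (real k * pi)\<^sup>2) * sin (real k * pi * x)
      + (real k * pi / \<epsilon>) * cos (real k * pi * x))" for k x
  have d1: "(mode \<epsilon> k has_real_derivative m1 k x) (at x)" for k x
    unfolding mode_def[abs_def] m1_def using \<epsilon>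
    by (auto intro!: derivative_eq_intros simp: field_simps)
  have d2: "(m1 k has_real_derivative m2 k x) (at x)" for k x
    unfolding m1_def[abs_def] m2_def using \<epsilon>
    by (auto intro!: derivative_eq_intros simp: field_simps power2_eq_square)
  have c2: "continuous_on UNIV (m2 k)" for k
    unfolding m2_def[abs_def] divide_inverse by (intro continuous_intros)
  have bc: "mode \<epsilon> k 0 = 0" "mode \<epsilon> k 1 = 0" for k
    by (simp_all add: mode_def)
  have "- (e * (s / (2 * \<epsilon>) + a * c)) + \<epsilon> * (e * ((1 / (4 * \<epsilon>\<^sup>2) - a\<^sup>2) * s + (a / \<epsilon>) * c))
      = - (1 / (4 * \<epsilon>) + \<epsilon> * a\<^sup>2) * (e * s)" for a c e s :: real
    using \<epsilon> by (simp add: field_simps power2_eq_square)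
  then have eig: "- m1 k x + \<epsilon> * m2 k x = - decay \<epsilon> k * mode \<epsilon> k x" for k x
    unfolding m1_def m2_def mode_def decay_def .
  show ?sol ?reg
    by (rule adjoint_solution_sum_eigenmodes[OF d1 d2 c2 bc eig])+
  have "((\<lambda>x. \<Sum>k\<in>I. c k * exp (- decay \<epsilon> k * t) * mode \<epsilon> k x) has_real_derivative
      (\<Sum>k\<in>I. c k * exp (- decay \<epsilon> k * t) * m1 k 0)) (at 0)"
    by (intro DERIV_sum DERIV_cmult d1)
  then show ?trace
    by (subst left_trace_deriv_eq) (auto simp: m1_def mult_ac)
qed

text \<open>
  The factor \<open>1 - (-1)\<^sup>k e\<^bsup>1/\<epsilon>\<^esup>\<close> consists of the contributions of the two endpoints; that of \<open>x = 1\<close>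
  dominates and alternates in sign with \<open>k\<close>.
\<close>

lemma integral_exp_mode:
  assumes \<epsilon>: "0 < \<epsilon>"
  shows "integral {0..1} (\<lambda>x. exp (x / (2 * \<epsilon>)) * mode \<epsilon> k x)
    = real k * pi * (1 - (-1) ^ k * exp (1 / \<epsilon>)) / ((real k * pi)\<^sup>2 + 1 / \<epsilon>\<^sup>2)"
proof -
  define a where "a = real k * pi"
  define d where "d = a\<^sup>2 + 1 / \<epsilon>\<^sup>2"
  have "d > 0" unfolding d_def using \<epsilon> by (intro add_nonneg_pos) auto
  define P where "P x = exp (x / \<epsilon>) * (sin (a * x) / \<epsilon> - a * cos (a * x)) / d" for x
  have D: "(P has_real_derivative exp (x / (2 * \<epsilon>)) * mode \<epsilon> k x) (at x)" for x
  proof -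
    have "((\<lambda>x. exp (x / \<epsilon>) * (sin (a * x) / \<epsilon> - a * cos (a * x))) has_real_derivative
        exp (x / \<epsilon>) * sin (a * x) * d) (at x)"
      using \<epsilon> by (auto intro!: derivative_eq_intros simp: d_def field_simps power2_eq_square)
    from DERIV_cdivide[OF this, of d]
    have "(P has_real_derivative exp (x / \<epsilon>) * sin (a * x)) (at x)"
      using \<open>d > 0\<close> by (simp add: P_def[abs_def])
    also have "exp (x / \<epsilon>) = exp (x / (2 * \<epsilon>)) * exp (x / (2 * \<epsilon>))"
      using \<epsilon> by (simp add: mult_exp_exp)
    finally show ?thesis by (simp add: mode_def a_def mult.assoc)
  qed
  have "((\<lambda>x. exp (x / (2 * \<epsilon>)) * mode \<epsilon> k x) has_integral P 1 - P 0) {0..1}"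
    using D by (intro fundamental_theorem_of_calculus)
      (auto simp: has_real_derivative_iff_has_vector_derivative[symmetric]
        intro: has_field_derivative_at_within)
  then have "integral {0..1} (\<lambda>x. exp (x / (2 * \<epsilon>)) * mode \<epsilon> k x) = P 1 - P 0"
    by (rule integral_unique)
  also have "\<dots> = a * (1 - (-1) ^ k * exp (1 / \<epsilon>)) / d"
  proof -
    have "sin a = 0" "cos a = (-1) ^ k" by (simp_all add: a_def)
    then show ?thesis by (simp add: P_def diff_divide_distrib[symmetric] algebra_simps)
  qed
  finally show ?thesis by (simp add: a_def d_def)
qed

text \<open>
  Pairing with \<open>e\<^bsup>x/(2\<epsilon>)\<^esup>\<close>. Coefficients with alternating signs compensate the alternating signs of
  \<open>integral_exp_mode\<close>, so that no cancellation occurs and the first mode bounds the pairing from below.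
  Since \<open>\<parallel>e\<^bsup>x/(2\<epsilon>)\<^esup>\<parallel>\<^sup>2 \<le> \<epsilon> e\<^bsup>1/\<epsilon>\<^esup>\<close>, Cauchy-Schwarz loses only powers of \<open>\<epsilon>\<close>.
\<close>

lemma L2_norm_alternating_mode_sum_ge:
  assumes \<epsilon>: "0 < \<epsilon>" and N: "1 \<le> N" and sgn: "\<And>k. k \<in> {1..N} \<Longrightarrow> 0 \<le> (-1) ^ (k + 1) * c k"
  shows "(c 1 * pi)\<^sup>2 * exp (1 / \<epsilon>) / (\<epsilon> * (pi\<^sup>2 + 1 / \<epsilon>\<^sup>2)\<^sup>2)
    \<le> (L2_norm {0<..<1} (\<lambda>x. \<Sum>k=1..N. c k * mode \<epsilon> k x))\<^sup>2"
proof -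
  define E where "E = exp (1 / \<epsilon>)"
  define v where "v x = (\<Sum>k=1..N. c k * mode \<epsilon> k x)" for x
  define h where "h x = exp (x / (2 * \<epsilon>))" for x
  define d where "d k = (real k * pi)\<^sup>2 + 1 / \<epsilon>\<^sup>2" for k
  have E: "1 \<le> E" using \<epsilon> by (simp add: E_def)
  have d: "0 < d k" for k unfolding d_def using \<epsilon> by (intro add_nonneg_pos) auto
  have cv: "continuous_on A v" and ch: "continuous_on A h" for A
    using \<epsilon> unfolding v_def h_def by (auto intro!: continuous_intros continuous_on_mode)
  have term_nonneg: "0 \<le> c k * (real k * pi * (1 - (-1) ^ k * E) / d k)" if "k \<in> {1..N}" for k
  proof -
    have "c k * (1 - (-1) ^ k * E) = (-1) ^ (k + 1) * c k * (E - (-1) ^ k)"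
      by (cases "even k") (simp_all add: algebra_simps)
    moreover have "0 \<le> E - (-1) ^ k" using E by (cases "even k") simp_all
    ultimately have "0 \<le> c k * (1 - (-1) ^ k * E)" using sgn[OF that] by (metis mult_nonneg_nonneg)
    then have "0 \<le> (c k * (1 - (-1) ^ k * E)) * (real k * pi / d k)"
      using d[of k] by simp
    then show ?thesis by (simp add: mult_ac)
  qed
  have c1: "0 \<le> c 1" using sgn[of 1] N by simp
  have "c 1 * pi * E / d 1 \<le> c 1 * (real 1 * pi * (1 - (-1) ^ 1 * E) / d 1)"
  proof -
    have "0 \<le> c 1 * pi / d 1" using c1 d[of 1] by simp
    then show ?thesis by (simp add: algebra_simps add_divide_distrib)
  qed
  also have "\<dots> \<le> (\<Sum>k=1..N. c k * (real k * pi * (1 - (-1) ^ k * E) / d k))"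
    using N term_nonneg by (intro member_le_sum) auto
  also have "\<dots> = (\<Sum>k=1..N. integral {0..1} (\<lambda>x. c k * (h x * mode \<epsilon> k x)))"
    using integral_exp_mode[OF \<epsilon>] by (simp add: h_def E_def d_def)
  also have "\<dots> = integral {0..1} (\<lambda>x. \<Sum>k=1..N. c k * (h x * mode \<epsilon> k x))"
  proof (rule Henstock_Kurzweil_Integration.integral_sum[symmetric])
    show "(\<lambda>x. c k * (h x * mode \<epsilon> k x)) integrable_on {0..1}" for k
      by (intro integrable_continuous_real continuous_on_mult continuous_on_const ch continuous_on_mode)
  qed simp
  also have "\<dots> = (LBINT x:{0<..<1}. h x * v x)"
  proof -
    have "(LBINT x:{0<..<1}. h x * v x) = integral {0..1} (\<lambda>x. h x * v x)"
      by (intro lborel_integral_continuous continuous_on_mult ch cv)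
    then show ?thesis by (simp add: v_def sum_distrib_left mult.left_commute)
  qed
  also have "\<dots> \<le> L2_norm {0<..<1} h * L2_norm {0<..<1} v"
    using L2_Cauchy_Schwarz[OF L2_continuous_on[OF ch] L2_continuous_on[OF cv], of 0 1] by linarith
  finally have "(c 1 * pi * E / d 1)\<^sup>2 \<le> (L2_norm {0<..<1} h * L2_norm {0<..<1} v)\<^sup>2"
    using c1 E d[of 1] by (intro power_mono) auto
  also have "\<dots> = (L2_norm {0<..<1} h)\<^sup>2 * (L2_norm {0<..<1} v)\<^sup>2"
    by (rule power_mult_distrib)
  also have "\<dots> \<le> (\<epsilon> * E) * (L2_norm {0<..<1} v)\<^sup>2"
  proof (rule mult_right_mono)
    have "((\<lambda>x. (h x)\<^sup>2) has_integral (\<epsilon> * exp (1 / \<epsilon>) - \<epsilon> * exp (0 / \<epsilon>))) {0..1}"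
    proof (rule fundamental_theorem_of_calculus)
      fix x :: real
      have "((\<lambda>x. \<epsilon> * exp (x / \<epsilon>)) has_real_derivative exp (x / \<epsilon>)) (at x)"
        using \<epsilon> by (auto intro!: derivative_eq_intros)
      moreover have "(h x)\<^sup>2 = exp (x / \<epsilon>)"
        using \<epsilon> by (simp add: h_def power2_eq_square mult_exp_exp)
      ultimately show "((\<lambda>x. \<epsilon> * exp (x / \<epsilon>)) has_vector_derivative (h x)\<^sup>2) (at x within {0..1})"
        by (simp add: has_real_derivative_iff_has_vector_derivative has_vector_derivative_at_within)
    qed simp
    then show "(L2_norm {0<..<1} h)\<^sup>2 \<le> \<epsilon> * E"
      using \<epsilon> by (simp add: L2_norm_power2_continuous[OF ch] integral_unique E_def)
  qed simp
  finally have "(c 1 * pi * E / d 1)\<^sup>2 / (\<epsilon> * E) \<le> (L2_norm {0<..<1} v)\<^sup>2"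
    using \<epsilon> E by (simp add: pos_divide_le_eq mult.commute)
  moreover have "(c 1 * pi * E / d 1)\<^sup>2 / (\<epsilon> * E) = (c 1 * pi)\<^sup>2 * E / (\<epsilon> * (d 1)\<^sup>2)"
    using \<epsilon> E d[of 1] by (simp add: power2_eq_square mult_ac)
  ultimately show ?thesis by (simp add: v_def[abs_def] E_def d_def)
qed

section \<open>The extremal solutions\<close>

text \<open>
  The division by \<open>k\<pi>\<close>, the slope of the \<open>k\<close>-th eigenmode at \<open>0\<close>, makes \<open>muntz_coeff\<close> the coefficients
  of the trace.
\<close>

definition extremal_solution :: "nat \<Rightarrow> real \<Rightarrow> real \<Rightarrow> real \<Rightarrow> real" where
  "extremal_solution N \<epsilon> t x = (\<Sum>k=1..N.
     muntz_coeff N (decay \<epsilon>) k / (real k * pi) * exp (- decay \<epsilon> k * t) * mode \<epsilon> k x)"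

lemma extremal_solution_trace:
  assumes "0 < \<epsilon>"
  shows "left_trace_deriv (extremal_solution N \<epsilon> t)
    = (\<Sum>k=1..N. muntz_coeff N (decay \<epsilon>) k * exp (- decay \<epsilon> k * t))"
proof -
  have "left_trace_deriv (extremal_solution N \<epsilon> t)
      = (\<Sum>k=1..N. muntz_coeff N (decay \<epsilon>) k / (real k * pi) * (real k * pi) * exp (- decay \<epsilon> k * t))"
    unfolding extremal_solution_def[abs_def] by (rule mode_sum_adjoint_solution(3)[OF assms])
  also have "\<dots> = (\<Sum>k=1..N. muntz_coeff N (decay \<epsilon>) k * exp (- decay \<epsilon> k * t))"
    by (intro sum.cong refl) auto
  finally show ?thesis .
qed

text \<open>
  The upper bound is the energy of the trace on the whole half line. Strict positivity is needed
  because the quotient by a vanishing trace would be \<open>0\<close>; it holds because exponentials are linearly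
  independent on every interval and the first coefficient is not zero.
\<close>

lemma extremal_solution_trace_norm:
  assumes \<epsilon>: "0 < \<epsilon>" and N: "1 \<le> N" and T: "0 < T"
  defines "D \<equiv> L2_norm {0<..<T} (\<lambda>t. \<epsilon> * left_trace_deriv (extremal_solution N \<epsilon> t))"
  shows "0 < D" and "D\<^sup>2 \<le> \<epsilon>\<^sup>2 / (2 * decay \<epsilon> 1)"
proof -
  define b where "b = muntz_coeff N (decay \<epsilon>)"
  define \<psi> where "\<psi> t = (\<Sum>k=1..N. b k * exp (- decay \<epsilon> k * t))" for t
  have trace: "left_trace_deriv (extremal_solution N \<epsilon> t) = \<psi> t" for t
    by (simp only: extremal_solution_trace[OF \<epsilon>] \<psi>_def b_def)
  have inj: "inj_on (decay \<epsilon>) {1..N}"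
    using strict_mono_decay[OF \<epsilon>] by (rule strict_mono_on_imp_inj_on)
  have c\<psi>: "continuous_on A \<psi>" for A unfolding \<psi>_def by (intro continuous_intros)
  have D2: "D\<^sup>2 = \<epsilon>\<^sup>2 * integral {0..T} (\<lambda>t. (\<psi> t)\<^sup>2)"
    unfolding D_def L2_norm_scale power_mult_distrib trace
    by (simp add: L2_norm_power2_continuous[OF c\<psi>])
  have "integral {0..T} (\<lambda>t. (\<psi> t)\<^sup>2) \<le> (\<Sum>j=1..N. \<Sum>k=1..N. b j * b k / (decay \<epsilon> j + decay \<epsilon> k))"
    unfolding \<psi>_def using T decay_pos[OF \<epsilon>] by (intro exponential_sum_energy_le) auto
  also have "\<dots> = 1 / (2 * decay \<epsilon> 1)"
    unfolding b_def by (intro muntz_coeff_energy inj N decay_pos \<epsilon>)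
  finally have "\<epsilon>\<^sup>2 * integral {0..T} (\<lambda>t. (\<psi> t)\<^sup>2) \<le> \<epsilon>\<^sup>2 * (1 / (2 * decay \<epsilon> 1))"
    by (intro mult_left_mono) auto
  then show "D\<^sup>2 \<le> \<epsilon>\<^sup>2 / (2 * decay \<epsilon> 1)" by (simp add: D2)
  have "D \<noteq> 0"
  proof
    assume "D = 0"
    then have "integral {0..T} (\<lambda>t. (\<psi> t)\<^sup>2) = 0" using D2 \<epsilon> by simp
    moreover have "(\<lambda>t. (\<psi> t)\<^sup>2) integrable_on {0..T}"
      by (intro integrable_continuous_real continuous_intros c\<psi>)
    ultimately have "((\<lambda>t. (\<psi> t)\<^sup>2) has_integral 0) (cbox 0 T)"
      by (metis box_real(2) integrable_integral)
    then have "(\<psi> t)\<^sup>2 = 0" if "t \<in> {0<..<T}" for t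
      using that T by (intro has_integral_0_cbox_imp_0[of 0 T "\<lambda>t. (\<psi> t)\<^sup>2"])
        (auto intro!: continuous_intros c\<psi>)
    then have "b 1 = 0"
      using inj T N by (intro exponentials_independent[of "{1..N}" "decay \<epsilon>" 0 T b 1]) (auto simp: \<psi>_def)
    then show False
      using muntz_coeff_sign[OF strict_mono_decay[OF \<epsilon>], of 1 N] decay_pos[OF \<epsilon>] N by (simp add: b_def)
  qed
  then show "0 < D" using L2_norm_nonneg unfolding D_def by (metis less_eq_real_def)
qed

lemma extremal_solution_final_norm:
  assumes \<epsilon>: "0 < \<epsilon>" and N: "1 \<le> N"
  shows "(muntz_coeff N (decay \<epsilon>) 1 * exp (- decay \<epsilon> 1 * T))\<^sup>2 * exp (1 / \<epsilon>) / (\<epsilon> * (pi\<^sup>2 + 1 / \<epsilon>\<^sup>2)\<^sup>2)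
    \<le> (L2_norm {0<..<1} (extremal_solution N \<epsilon> T))\<^sup>2"
proof -
  define c where "c k = muntz_coeff N (decay \<epsilon>) k / (real k * pi) * exp (- decay \<epsilon> k * T)" for k
  have "0 \<le> (-1) ^ (k + 1) * c k" if "k \<in> {1..N}" for k
  proof -
    have "0 < (-1) ^ (k + 1) * muntz_coeff N (decay \<epsilon>) k"
      by (intro muntz_coeff_sign strict_mono_decay decay_pos \<epsilon> that)
    then have "0 \<le> ((-1) ^ (k + 1) * muntz_coeff N (decay \<epsilon>) k) * (exp (- decay \<epsilon> k * T) / (real k * pi))"
      by (intro mult_nonneg_nonneg[OF less_imp_le]) auto
    then show ?thesis by (simp add: c_def)
  qed
  from L2_norm_alternating_mode_sum_ge[OF \<epsilon> N this]
  show ?thesis by (simp add: c_def extremal_solution_def[abs_def])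
qed

text \<open>
  All factors except the first residue are estimated here. The powers of \<open>\<epsilon>\<close> cancel: the squared norm
  of the final state carries \<open>\<epsilon>\<^sup>3\<close>, and so does that of the trace, because \<open>\<lambda>\<^sub>1 \<ge> 1/(4\<epsilon>)\<close>. The
  condition \<open>\<epsilon> \<le> 1/10\<close> serves to absorb \<open>\<pi>\<^sup>2\<close> into \<open>1/\<epsilon>\<^sup>2\<close>.
\<close>

lemma extremal_solution_ratio:
  assumes \<epsilon>: "0 < \<epsilon>" "\<epsilon> \<le> 1 / 10" and N: "1 \<le> N" and T: "0 < T"
  shows "(muntz_coeff N (decay \<epsilon>) 1)\<^sup>2 * exp ((2 - T) / (2 * \<epsilon>)) * exp (- 2 * pi\<^sup>2 * T) / 8
    \<le> (L2_norm {0<..<1} (extremal_solution N \<epsilon> T))\<^sup>2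
      / (L2_norm {0<..<T} (\<lambda>t. \<epsilon> * left_trace_deriv (extremal_solution N \<epsilon> t)))\<^sup>2"
proof -
  define n where "n = (L2_norm {0<..<1} (extremal_solution N \<epsilon> T))\<^sup>2"
  define D where "D = L2_norm {0<..<T} (\<lambda>t. \<epsilon> * left_trace_deriv (extremal_solution N \<epsilon> t))"
  define b where "b = muntz_coeff N (decay \<epsilon>) 1"
  have D: "0 < D" "D\<^sup>2 \<le> \<epsilon>\<^sup>2 / (2 * decay \<epsilon> 1)"
    using extremal_solution_trace_norm[OF \<epsilon>(1) N T] by (simp_all add: D_def)
  have n: "(b * exp (- decay \<epsilon> 1 * T))\<^sup>2 * exp (1 / \<epsilon>) / (\<epsilon> * (pi\<^sup>2 + 1 / \<epsilon>\<^sup>2)\<^sup>2) \<le> n"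
    using extremal_solution_final_norm[OF \<epsilon>(1) N] by (simp add: n_def b_def)
  have "D\<^sup>2 \<le> 2 * \<epsilon> ^ 3"
  proof -
    have "1 / (4 * \<epsilon>) \<le> decay \<epsilon> 1" using \<epsilon> by (simp add: decay_def)
    then have "\<epsilon>\<^sup>2 / (2 * decay \<epsilon> 1) \<le> \<epsilon>\<^sup>2 / (2 * (1 / (4 * \<epsilon>)))"
      using \<epsilon> decay_pos[of \<epsilon> 1] by (intro divide_left_mono mult_pos_pos) auto
    also have "\<dots> = 2 * \<epsilon> ^ 3" by (simp add: power2_eq_square power3_eq_cube)
    finally show ?thesis using D(2) by linarith
  qed
  have "pi\<^sup>2 + 1 / \<epsilon>\<^sup>2 \<le> 2 / \<epsilon>\<^sup>2"
  proof -
    have "pi * \<epsilon> \<le> 4 * (1 / 10)" using \<epsilon> pi_less_4 by (intro mult_mono) auto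
    then have "(pi * \<epsilon>)\<^sup>2 \<le> 1\<^sup>2" using \<epsilon> by (intro power_mono) auto
    then have "pi\<^sup>2 \<le> 1 / \<epsilon>\<^sup>2" using \<epsilon> by (simp add: power_mult_distrib field_simps)
    then show ?thesis by simp
  qed
  then have "(pi\<^sup>2 + 1 / \<epsilon>\<^sup>2)\<^sup>2 \<le> (2 / \<epsilon>\<^sup>2)\<^sup>2" by (intro power_mono) auto
  also have "\<dots> = 4 / \<epsilon> ^ 4" by (simp add: power_divide)
  finally have e4: "\<epsilon> * (pi\<^sup>2 + 1 / \<epsilon>\<^sup>2)\<^sup>2 \<le> \<epsilon> * (4 / \<epsilon> ^ 4)" using \<epsilon> by (intro mult_left_mono) auto
  have "D\<^sup>2 * (\<epsilon> * (pi\<^sup>2 + 1 / \<epsilon>\<^sup>2)\<^sup>2) \<le> (2 * \<epsilon> ^ 3) * (\<epsilon> * (4 / \<epsilon> ^ 4))"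
    by (rule mult_mono[OF \<open>D\<^sup>2 \<le> 2 * \<epsilon> ^ 3\<close> e4]) (use \<epsilon> in auto)
  also have "\<dots> = 8" using \<epsilon> by (simp add: power_numeral_reduce)
  finally have den: "D\<^sup>2 * (\<epsilon> * (pi\<^sup>2 + 1 / \<epsilon>\<^sup>2)\<^sup>2) \<le> 8" .
  have pos: "0 < pi\<^sup>2 + 1 / \<epsilon>\<^sup>2" using \<epsilon> by (intro add_nonneg_pos) auto
  have "exp ((2 - T) / (2 * \<epsilon>)) * exp (- 2 * pi\<^sup>2 * T) \<le> (exp (- decay \<epsilon> 1 * T))\<^sup>2 * exp (1 / \<epsilon>)"
  proof -
    have "(exp (- decay \<epsilon> 1 * T))\<^sup>2 * exp (1 / \<epsilon>) = exp ((2 - T) / (2 * \<epsilon>) + - 2 * \<epsilon> * (pi\<^sup>2 * T))"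
      using \<epsilon> unfolding power2_eq_square[of "exp _"] mult_exp_exp
      by (simp add: decay_def field_simps power2_eq_square)
    moreover have "- 2 * pi\<^sup>2 * T \<le> - 2 * \<epsilon> * (pi\<^sup>2 * T)"
      using \<epsilon> T by (simp add: mult_right_mono[of \<epsilon> 1 "pi\<^sup>2 * T", simplified])
    ultimately show ?thesis by (simp add: mult_exp_exp)
  qed
  then have "b\<^sup>2 * (exp ((2 - T) / (2 * \<epsilon>)) * exp (- 2 * pi\<^sup>2 * T)) / 8
      \<le> b\<^sup>2 * ((exp (- decay \<epsilon> 1 * T))\<^sup>2 * exp (1 / \<epsilon>)) / 8"
    by (intro divide_right_mono mult_left_mono) auto
  also have "\<dots> \<le> b\<^sup>2 * ((exp (- decay \<epsilon> 1 * T))\<^sup>2 * exp (1 / \<epsilon>)) / (D\<^sup>2 * (\<epsilon> * (pi\<^sup>2 + 1 / \<epsilon>\<^sup>2)\<^sup>2))"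
    using den D(1) \<epsilon> pos by (intro divide_left_mono) auto
  also have "\<dots> = ((b * exp (- decay \<epsilon> 1 * T))\<^sup>2 * exp (1 / \<epsilon>) / (\<epsilon> * (pi\<^sup>2 + 1 / \<epsilon>\<^sup>2)\<^sup>2)) / D\<^sup>2"
    by (simp add: power_mult_distrib mult_ac)
  also have "\<dots> \<le> n / D\<^sup>2"
    using n by (rule divide_right_mono) simp
  finally show ?thesis by (simp add: n_def D_def b_def mult.assoc)
qed

text \<open>
  The \<open>j\<close>-th factor of the first residue is \<open>(j\<^sup>2 + a\<^sup>2)/(j\<^sup>2 - 1) \<ge> 1 + a\<^sup>2/j\<^sup>2\<close> with
  \<open>a\<^sup>2 = 1 + 1/(2\<pi>\<^sup>2\<epsilon>\<^sup>2)\<close>. The truncated product for \<open>sinh (\<pi> a)\<close>, without its factor \<open>1 + a\<^sup>2\<close> for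
  \<open>j = 1\<close>, is therefore a lower bound, and \<open>1/(\<surd>2 \<epsilon>) \<le> \<pi>a \<le> 1/\<epsilon>\<close> makes it explicit.
\<close>

lemma exists_muntz_coeff_first_ge:
  assumes \<epsilon>: "0 < \<epsilon>" "\<epsilon> \<le> 1 / 10"
  shows "\<exists>N\<ge>1. \<epsilon> ^ 3 * exp (sqrt 2 / (2 * \<epsilon>)) / 16 \<le> muntz_coeff N (decay \<epsilon>) 1"
proof -
  define a where "a = sqrt (1 + 1 / (2 * (pi * \<epsilon>)\<^sup>2))"
  have a2: "a\<^sup>2 = 1 + 1 / (2 * (pi * \<epsilon>)\<^sup>2)" by (simp add: a_def)
  have "a > 0" by (simp add: a_def add_pos_nonneg)
  then obtain N where N: "1 \<le> N" "sinh (pi * a) / (2 * (pi * a)) \<le> (\<Prod>j=1..N. 1 + a\<^sup>2 / (real j)\<^sup>2)"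
    using exists_prod_ge_sinh by blast
  have pa2: "(pi * a)\<^sup>2 = pi\<^sup>2 + 1 / (2 * \<epsilon>\<^sup>2)"
    using \<epsilon> by (simp add: power_mult_distrib a2 field_simps)
  have "pi * \<epsilon> \<le> 4 * (1 / 10)" using \<epsilon> pi_less_4 by (intro mult_mono) auto
  then have "(pi * \<epsilon>)\<^sup>2 \<le> (4 / 10)\<^sup>2" using \<epsilon> by (intro power_mono) auto
  then have "pi\<^sup>2 \<le> 1 / (2 * \<epsilon>\<^sup>2)" using \<epsilon> by (simp add: power_mult_distrib power2_eq_square field_simps)
  then have "(pi * a)\<^sup>2 \<le> (1 / \<epsilon>)\<^sup>2" unfolding pa2 by (simp add: power_divide field_simps)
  then have pa_upper: "pi * a \<le> 1 / \<epsilon>" by (rule power2_le_imp_le) (use \<epsilon> in simp)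
  have "(sqrt 2 / (2 * \<epsilon>))\<^sup>2 \<le> (pi * a)\<^sup>2"
    unfolding pa2 by (simp add: power_divide power_mult_distrib)
  then have pa_lower: "sqrt 2 / (2 * \<epsilon>) \<le> pi * a"
    by (rule power2_le_imp_le) (use \<open>a > 0\<close> in simp)
  have "1 \<le> sqrt 2 / (2 * \<epsilon>)"
  proof -
    have "1 \<le> sqrt 2" by simp
    then have "2 * \<epsilon> \<le> sqrt 2" using \<epsilon> by linarith
    then show ?thesis using \<epsilon> by (simp add: field_simps)
  qed
  then have "1 \<le> pi * a" using pa_lower by linarith
  have a_upper: "1 + a\<^sup>2 \<le> 2 / \<epsilon>\<^sup>2"
  proof -
    have "1 * a \<le> pi * a" using \<open>a > 0\<close> pi_gt3 by (intro mult_right_mono) auto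
    then have "a \<le> 1 / \<epsilon>" using pa_upper by linarith
    then have "a\<^sup>2 \<le> (1 / \<epsilon>)\<^sup>2" using \<open>a > 0\<close> by (intro power_mono) auto
    moreover have "1\<^sup>2 \<le> (1 / \<epsilon>)\<^sup>2" using \<epsilon> by (intro power_mono) auto
    ultimately show ?thesis by (simp add: power_divide)
  qed
  have "exp (sqrt 2 / (2 * \<epsilon>)) / 4 \<le> exp (pi * a) / 4" using pa_lower by simp
  also have "\<dots> \<le> sinh (pi * a)"
  proof -
    have "exp (- (pi * a)) \<le> 1" using \<open>1 \<le> pi * a\<close> by simp
    moreover have "2 \<le> exp (pi * a)" using exp_ge_add_one_self[of "pi * a"] \<open>1 \<le> pi * a\<close> by linarith
    ultimately have "2 * exp (- (pi * a)) \<le> exp (pi * a)" by linarith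
    then show ?thesis by (simp add: sinh_field_def field_simps)
  qed
  finally have sinh_lower: "exp (sqrt 2 / (2 * \<epsilon>)) / 4 \<le> sinh (pi * a)" .
  have "\<epsilon> ^ 3 * exp (sqrt 2 / (2 * \<epsilon>)) / 16 = (exp (sqrt 2 / (2 * \<epsilon>)) / 4) / (2 * (1 / \<epsilon>) * (2 / \<epsilon>\<^sup>2))"
    using \<epsilon> by (simp add: power2_eq_square power3_eq_cube)
  also have "\<dots> \<le> sinh (pi * a) / (2 * (pi * a) * (1 + a\<^sup>2))"
    using sinh_lower pa_upper a_upper \<open>1 \<le> pi * a\<close> \<open>a > 0\<close> \<epsilon>
    by (intro frac_le mult_mono mult_pos_pos add_pos_nonneg) auto
  also have "\<dots> = sinh (pi * a) / (2 * (pi * a)) / (1 + a\<^sup>2)"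
    by simp
  also have "\<dots> \<le> (\<Prod>j=1..N. 1 + a\<^sup>2 / (real j)\<^sup>2) / (1 + a\<^sup>2)"
    using N(2) by (intro divide_right_mono) auto
  also have "\<dots> = (\<Prod>j\<in>{2..N}. 1 + a\<^sup>2 / (real j)\<^sup>2)"
  proof -
    have "{1..N} = insert 1 {2..N}" using N by auto
    moreover have "1 + a\<^sup>2 \<noteq> 0" using zero_le_power2[of a] by linarith
    ultimately show ?thesis by simp
  qed
  also have "\<dots> \<le> (\<Prod>j\<in>{2..N}. (decay \<epsilon> j + decay \<epsilon> 1) / (decay \<epsilon> j - decay \<epsilon> 1))"
  proof (rule prod_mono, intro conjI)
    fix j assume j: "j \<in> {2..N}"
    have "2\<^sup>2 \<le> (real j)\<^sup>2" using j by (intro power_mono) auto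
    then have j2: "1 < (real j)\<^sup>2" by simp
    have "1 + a\<^sup>2 / (real j)\<^sup>2 = ((real j)\<^sup>2 + a\<^sup>2) / (real j)\<^sup>2" using j by (simp add: field_simps)
    also have "\<dots> \<le> ((real j)\<^sup>2 + a\<^sup>2) / ((real j)\<^sup>2 - 1)"
      using j j2 by (intro divide_left_mono mult_pos_pos) auto
    also have "\<dots> = (\<epsilon> * pi\<^sup>2 * ((real j)\<^sup>2 + a\<^sup>2)) / (\<epsilon> * pi\<^sup>2 * ((real j)\<^sup>2 - 1))"
      using \<epsilon> by (intro mult_divide_mult_cancel_left[symmetric]) auto
    also have "\<epsilon> * pi\<^sup>2 * ((real j)\<^sup>2 + a\<^sup>2) = decay \<epsilon> j + decay \<epsilon> 1"
      using \<epsilon> by (simp add: a2 decay_def power_mult_distrib) (simp add: field_simps power2_eq_square)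
    also have "\<epsilon> * pi\<^sup>2 * ((real j)\<^sup>2 - 1) = decay \<epsilon> j - decay \<epsilon> 1"
      by (simp add: decay_def power_mult_distrib algebra_simps)
    finally show "1 + a\<^sup>2 / (real j)\<^sup>2 \<le> (decay \<epsilon> j + decay \<epsilon> 1) / (decay \<epsilon> j - decay \<epsilon> 1)" .
  qed simp
  also have "\<dots> = muntz_coeff N (decay \<epsilon>) 1" by (rule muntz_coeff_first[OF N(1), symmetric])
  finally show ?thesis using N(1) by blast
qed

theorem theorem5p4:
  fixes T :: real
  assumes "0 < T" and "T < 2 + 2 * sqrt 2"
  shows "\<exists>C>0. \<exists>z :: real \<Rightarrow> real \<Rightarrow> real \<Rightarrow> real.
    (\<forall>\<epsilon>>0. adjoint_solution \<epsilon> T (z \<epsilon>) \<and> z \<epsilon> 0 \<in> H10 \<inter> H2) \<and>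
    (\<forall>\<^sub>F \<epsilon> in at_right 0.
       (L2_norm {0<..<1} (z \<epsilon> T))\<^sup>2
         / (L2_norm {0<..<T} (\<lambda>t. \<epsilon> * left_trace_deriv (z \<epsilon> t)))\<^sup>2
       \<ge> C * \<epsilon> ^ 9 * exp ((2 + 2 * sqrt 2 - T) / (2 * \<epsilon>))) \<and>
    (\<forall>\<^sub>F \<epsilon> in at_right 0.
       control_cost \<epsilon> T
       \<ge> ennreal (sqrt C * \<epsilon> powr (9 / 2) * exp ((2 + 2 * sqrt 2 - T) / (4 * \<epsilon>))))"
proof -
  \<comment> \<open>The constant collects the factor \<open>e\<^bsup>-2\<epsilon>\<pi>\<^sup>2T\<^esup> \<ge> e\<^bsup>-2\<pi>\<^sup>2T\<^esup>\<close>, the \<open>8\<close> of \<open>extremal_solution_ratio\<close> and the \<open>16\<^sup>2\<close> of the squared first residue.\<close>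
  define C where "C = exp (- 2 * pi\<^sup>2 * T) / 2048"
  have "C > 0" by (simp add: C_def)
  have "\<exists>N. \<forall>\<epsilon>. 0 < \<epsilon> \<and> \<epsilon> \<le> 1 / 10 \<longrightarrow>
      1 \<le> N \<epsilon> \<and> \<epsilon> ^ 3 * exp (sqrt 2 / (2 * \<epsilon>)) / 16 \<le> muntz_coeff (N \<epsilon>) (decay \<epsilon>) 1"
    using exists_muntz_coeff_first_ge by (intro choice) blast
  then obtain N where N: "\<And>\<epsilon>. 0 < \<epsilon> \<Longrightarrow> \<epsilon> \<le> 1 / 10 \<Longrightarrow> 1 \<le> N \<epsilon>"
    and b: "\<And>\<epsilon>. 0 < \<epsilon> \<Longrightarrow> \<epsilon> \<le> 1 / 10 \<Longrightarrow>
      \<epsilon> ^ 3 * exp (sqrt 2 / (2 * \<epsilon>)) / 16 \<le> muntz_coeff (N \<epsilon>) (decay \<epsilon>) 1"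
    by blast
  define z where "z \<epsilon> = extremal_solution (N \<epsilon>) \<epsilon>" for \<epsilon>
  have sol: "adjoint_solution \<epsilon> T (z \<epsilon>)" "z \<epsilon> 0 \<in> H10 \<inter> H2" if "0 < \<epsilon>" for \<epsilon>
    unfolding z_def extremal_solution_def[abs_def] by (rule mode_sum_adjoint_solution[OF that])+
  have ratio: "C * \<epsilon> ^ 9 * exp ((2 + 2 * sqrt 2 - T) / (2 * \<epsilon>))
      \<le> (L2_norm {0<..<1} (z \<epsilon> T))\<^sup>2 / (L2_norm {0<..<T} (\<lambda>t. \<epsilon> * left_trace_deriv (z \<epsilon> t)))\<^sup>2"
    if \<epsilon>: "0 < \<epsilon>" "\<epsilon> \<le> 1 / 10" for \<epsilon>
  proof -
    have "C * \<epsilon> ^ 9 * exp ((2 + 2 * sqrt 2 - T) / (2 * \<epsilon>))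
        \<le> C * \<epsilon> ^ 6 * exp ((2 + 2 * sqrt 2 - T) / (2 * \<epsilon>))"
      using \<epsilon> \<open>C > 0\<close> by (intro mult_right_mono mult_left_mono power_decreasing) auto
    also have "\<dots> = (\<epsilon> ^ 3 * exp (sqrt 2 / (2 * \<epsilon>)) / 16)\<^sup>2 * exp ((2 - T) / (2 * \<epsilon>)) * exp (- 2 * pi\<^sup>2 * T) / 8"
    proof -
      have "exp ((2 + 2 * sqrt 2 - T) / (2 * \<epsilon>)) = (exp (sqrt 2 / (2 * \<epsilon>)))\<^sup>2 * exp ((2 - T) / (2 * \<epsilon>))"
        using \<epsilon> by (simp add: power2_eq_square mult_exp_exp add_divide_distrib diff_divide_distrib)
      then show ?thesis by (simp add: C_def power_mult_distrib power_divide)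
    qed
    also have "\<dots> \<le> (muntz_coeff (N \<epsilon>) (decay \<epsilon>) 1)\<^sup>2 * exp ((2 - T) / (2 * \<epsilon>)) * exp (- 2 * pi\<^sup>2 * T) / 8"
      using b[OF \<epsilon>] \<epsilon> by (intro divide_right_mono mult_right_mono power_mono) auto
    also have "\<dots> \<le> (L2_norm {0<..<1} (z \<epsilon> T))\<^sup>2 / (L2_norm {0<..<T} (\<lambda>t. \<epsilon> * left_trace_deriv (z \<epsilon> t)))\<^sup>2"
      unfolding z_def by (rule extremal_solution_ratio[OF \<epsilon> N[OF \<epsilon>] assms(1)])
    finally show ?thesis .
  qed
  have cost: "ennreal (sqrt C * \<epsilon> powr (9 / 2) * exp ((2 + 2 * sqrt 2 - T) / (4 * \<epsilon>))) \<le> control_cost \<epsilon> T"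
    if \<epsilon>: "0 < \<epsilon>" "\<epsilon> \<le> 1 / 10" for \<epsilon>
  proof -
    let ?n = "L2_norm {0<..<1} (z \<epsilon> T)" and ?D = "L2_norm {0<..<T} (\<lambda>t. \<epsilon> * left_trace_deriv (z \<epsilon> t))"
    have "(sqrt C * \<epsilon> powr (9 / 2) * exp ((2 + 2 * sqrt 2 - T) / (4 * \<epsilon>)))\<^sup>2
        = C * \<epsilon> ^ 9 * exp ((2 + 2 * sqrt 2 - T) / (2 * \<epsilon>))"
    proof -
      have "(\<epsilon> powr (9 / 2))\<^sup>2 = \<epsilon> ^ 9"
        using \<epsilon> by (simp add: power2_eq_square powr_add[symmetric] powr_numeral)
      moreover have "(exp ((2 + 2 * sqrt 2 - T) / (4 * \<epsilon>)))\<^sup>2 = exp ((2 + 2 * sqrt 2 - T) / (2 * \<epsilon>))"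
        by (simp add: power2_eq_square mult_exp_exp)
      ultimately show ?thesis using \<open>C > 0\<close> by (simp add: power_mult_distrib)
    qed
    also have "\<dots> \<le> (?n / ?D)\<^sup>2" using ratio[OF \<epsilon>] by (simp add: power_divide)
    finally have "sqrt C * \<epsilon> powr (9 / 2) * exp ((2 + 2 * sqrt 2 - T) / (4 * \<epsilon>)) \<le> ?n / ?D"
      by (rule power2_le_imp_le) (simp add: L2_norm_nonneg)
    then have "ennreal (sqrt C * \<epsilon> powr (9 / 2) * exp ((2 + 2 * sqrt 2 - T) / (4 * \<epsilon>))) \<le> ennreal (?n / ?D)"
      by (rule ennreal_leI)
    also have "\<dots> \<le> control_cost \<epsilon> T"
    proof (rule control_cost_ge)
      show "continuous_on {0..T} (\<lambda>t. left_trace_deriv (z \<epsilon> t))"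
        unfolding z_def extremal_solution_trace[OF \<epsilon>(1)] by (intro continuous_intros)
      show "0 < ?D"
        unfolding z_def by (rule extremal_solution_trace_norm(1)[OF \<epsilon>(1) N[OF \<epsilon>] assms(1)])
    qed (use sol \<epsilon> assms in auto)
    finally show ?thesis .
  qed
  have small: "\<forall>\<^sub>F \<epsilon> in at_right (0 :: real). 0 < \<epsilon> \<and> \<epsilon> \<le> 1 / 10"
    unfolding eventually_at_right_field by (rule exI[of _ "1 / 10"]) auto
  show ?thesis
    using \<open>C > 0\<close> sol eventually_mono[OF small ratio] eventually_mono[OF small cost]
    by (intro exI[of _ C] conjI exI[of _ z]) auto
qed

end
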